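(* There is a constant $c>0$ such that the following holds. For any $L>0$, $\Delta>0$, $p\in(1,2]$, $\sigma>0$, any $\{\tau_i>0\}_{i=1}^n$, and any $\epsilon>0$ with $\epsilon\le c\sqrt{L\Delta}$, there exists an $L$-smooth function $f:\mathbb{R}^d\to\mathbb{R}$ (for some dimension $d$) associated with stochastic first-order oracles $\{O^{\widehat\nabla F}_{\tau_i}\}_{i=1}^n$ (as defined in the context) such that any asynchronous stochastic first-order oracle algorithm $\mathcal{A}=\{A_k\}_{k\ge0}$ over $n$ workers under the fixed computation model (as defined in the context), with initial point $x_0\in\mathbb{R}^d$ such that $f(x_0)-\inf_{x\in\mathbb{R}^d}f(x)\le\Delta$, requires at least the time complexity of $$\Omega\left(\min_{m\in\{1,\dots,n\}}\left(\frac1m\sum_{i=1}^m\frac1{\tau_i}\right)^{-1}\left(\frac{L\Delta}{\epsilon^2}+\frac{L\sigma^{\frac{p}{p-1}}\Delta}{m\,\epsilon^{\frac{3p-2}{p-1}}}\right)\right)$$ for finding an $\epsilon$-stationary point $\hat x\in\mathbb{R}^d$, i.e. a point such that $\mathbb{E}[\|\nabla f(\hat x)\|]\le\epsilon$.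
   Context: $L$-smooth: $\|\nabla f(x)-\nabla f(y)\|\le L\|x-y\|$ for all $x,y\in\mathbb{R}^d$. For $v=[v_{(1)},\dots,v_{(d)}]^\top\in\mathbb{R}^d$, $\mathrm{supp}(v)=\{j: v_{(j)}\ne0\}$. The symbol $\Omega(\cdot)$ hides a positive constant factor depending at most on $p$ (not on $L,\Delta,\sigma,\epsilon,n$ or the $\tau_i$). Fixed computation model: worker $i\in\{1,\dots,n\}$ takes no more than $\tau_i>0$ units of wall-clock time to draw $\xi\sim\mathcal{D}$ and access a single stochastic gradient estimate at a given point. Asynchronous stochastic first-order oracle algorithm over $n$ workers under the fixed computation model. Each worker $i$ maintains an internal state $s_i=(s_{t,i},s_{x,i},s_{q,i})\in\mathbb{R}_{\ge0}\times\mathbb{R}^d\times\{0,1\}$, where $s_{t,i}$ is the start time of the current computation, $s_{x,i}$ is the corresponding requested point, and $s_{q,i}$ is $0$ when worker $i$ is idle and $1$ when it is busy; workers are initially idle. Worker $i$ is associated with a time-sensitive stochastic first-order oracle, which takes as input the current time $t$, the requested point $x$ and the current state $s_i$, and outputs $(s_{i,+},g)$ (the new state and a returned vector): $$O^{\widehat\nabla F}_{\tau_i}(t,x,s_i)=\begin{cases}((t,x,1),0), & s_{q,i}=0,\\ ((s_{t,i},s_{x,i},1),0), & s_{q,i}=1\text{ and } t<s_{t,i}+\tau_i,\\ ((0,0,0),\widehat\nabla F(s_{x,i};\xi)), & s_{q,i}=1\text{ and } t\ge s_{t,i}+\tau_i,\end{cases}$$ where $\xi$ is sampled from a distribution $\mathcal{D}$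 (independently across oracle calls) and the stochastic gradient estimator satisfies $\mathbb{E}[\widehat\nabla F(x;\xi)]=\nabla f(x)$ and $\mathbb{E}[\|\widehat\nabla F(x;\xi)-\nabla f(x)\|^p]\le\sigma^p$ at every requested point $x$. The algorithm $\mathcal{A}=\{A_k\}_{k\ge0}$ initializes $t_0=0$ and $x_0\in\mathbb{R}^d$ and calls the oracles during the iterations: at round $k$, after observing the vectors $g_1,\dots,g_k$ output by the past oracle calls, it selects a wall-clock time $t_{k+1}\ge t_k$, a worker $i_{k+1}\in\{1,\dots,n\}$ and a point $x_k$, $$(t_{k+1},i_{k+1},x_k)=A_k(g_1,\dots,g_k),$$ where $x_k\in\mathbb{R}^d$ satisfies $\mathrm{supp}(x_k)\subseteq\bigcup_{s=1}^k\mathrm{supp}(g_s)$; the oracle of worker $i_{k+1}$ is then called at time $t_{k+1}$ with point $x_k$ and that worker's state, which updates the state and returns $g_{k+1}$. The time complexity of finding an $\epsilon$-stationary point is the wall-clock time $t$ needed for one to be found among the iterates available by time $t$, namely $\{x_k: k\in S_t\}$ with $S_t=\{k\ge0: t_k\le t\}$.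
   Formalization: The bound is stated with τ_1,…,τ_n sorted increasingly (τ_i read as the i-th smallest); for unsorted τ_i the literal formula fails, e.g. τ_n=1, the others huge, σ tiny: it claims order nLΔ/ε², yet gradient descent on worker n alone needs only order LΔ/ε². *)

theory Defs
  imports "HOL-Probability.Probability"
begin

text \<open>
  The dimension is existentially quantified in the main statement, so it cannot be a type.
  As in \<^const>\<open>Euclidean_space\<close>, a vector of the d-dimensional space is a function on
  \<^typ>\<open>nat\<close> that vanishes outside the indices 0, ..., d - 1.
\<close>

type_synonym vector = "nat \<Rightarrow> real"

abbreviation Rd :: "nat \<Rightarrow> vector set" where
  "Rd d \<equiv> topspace (Euclidean_space d)"

abbreviation borel_Rd :: "nat \<Rightarrow> vector measure" where
  "borel_Rd d \<equiv> restrict_space borel (Rd d)"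

abbreviation zero_vec :: vector where
  "zero_vec \<equiv> (\<lambda>_. 0)"

definition norm_Rd :: "nat \<Rightarrow> vector \<Rightarrow> real" where
  "norm_Rd d v = L2_set v {..<d}"

definition dist_Rd :: "nat \<Rightarrow> vector \<Rightarrow> vector \<Rightarrow> real" where
  "dist_Rd d x y = norm_Rd d (\<lambda>j. x j - y j)"

definition supp :: "vector \<Rightarrow> nat set" where
  "supp v = {j. v j \<noteq> 0}"

definition has_gradient :: "nat \<Rightarrow> (vector \<Rightarrow> real) \<Rightarrow> vector \<Rightarrow> vector \<Rightarrow> bool" where
  "has_gradient d f v x \<longleftrightarrow> v \<in> Rd d \<and>
     (\<forall>e>0. \<exists>r>0. \<forall>y\<in>Rd d. dist_Rd d y x < r \<longrightarrow>
        \<bar>f y - f x - (\<Sum>j<d. v j * (y j - x j))\<bar> \<le> e * dist_Rd d y x)"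

definition L_smooth :: "nat \<Rightarrow> real \<Rightarrow> (vector \<Rightarrow> real) \<Rightarrow> (vector \<Rightarrow> vector) \<Rightarrow> bool" where
  "L_smooth d L f gradf \<longleftrightarrow>
     (\<forall>x\<in>Rd d. has_gradient d f (gradf x) x) \<and>
     (\<forall>x\<in>Rd d. \<forall>y\<in>Rd d. dist_Rd d (gradf x) (gradf y) \<le> L * dist_Rd d x y)"

text \<open>
  The expectation of the estimator is taken coordinatewise. The moment is a nonnegative
  Lebesgue integral, so the bound also asserts that it is finite.
\<close>

definition stochastic_gradient ::
  "nat \<Rightarrow> real \<Rightarrow> real \<Rightarrow> (vector \<Rightarrow> vector) \<Rightarrow> real measure \<Rightarrow> (vector \<Rightarrow> real \<Rightarrow> vector) \<Rightarrow> bool" where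
  "stochastic_gradient d p \<sigma> gradf D G \<longleftrightarrow>
     prob_space D \<and> sets D = sets borel \<and>
     case_prod G \<in> (borel_Rd d \<Otimes>\<^sub>M D) \<rightarrow>\<^sub>M borel_Rd d \<and>
     (\<forall>x\<in>Rd d.
        (\<forall>j<d. integrable D (\<lambda>\<xi>. G x \<xi> j) \<and> (\<integral>\<xi>. G x \<xi> j \<partial>D) = gradf x j) \<and>
        (\<integral>\<^sup>+\<xi>. ennreal (dist_Rd d (G x \<xi>) (gradf x) powr p) \<partial>D) \<le> ennreal (\<sigma> powr p))"

text \<open>A worker state consists of start time, requested point and busy flag.\<close>

type_synonym worker_state = "real \<times> vector \<times> bool"

abbreviation idle :: worker_state where
  "idle \<equiv> (0, zero_vec, False)"

fun sfo_oracle ::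
  "(vector \<Rightarrow> real \<Rightarrow> vector) \<Rightarrow> real \<Rightarrow> real \<Rightarrow> vector \<Rightarrow> worker_state \<Rightarrow> real \<Rightarrow> worker_state \<times> vector" where
  "sfo_oracle G \<tau> t x (s_t, s_x, s_q) \<xi> =
     (if \<not> s_q then ((t, x, True), zero_vec)
      else if t < s_t + \<tau> then ((s_t, s_x, True), zero_vec)
      else (idle, G s_x \<xi>))"

text \<open>
  An algorithm maps a round k and the history g, of which it may read only
  g 1, ..., g k, to the triple (next time, next worker, point of round k).
\<close>

type_synonym algorithm = "nat \<Rightarrow> (nat \<Rightarrow> vector) \<Rightarrow> real \<times> nat \<times> vector"

definition decision :: "algorithm \<Rightarrow> nat \<Rightarrow> (nat \<Rightarrow> vector) \<Rightarrow> real \<times> nat \<times> vector" where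
  "decision A k g = A k (restrict g {1..k})"

definition next_worker :: "algorithm \<Rightarrow> nat \<Rightarrow> (nat \<Rightarrow> vector) \<Rightarrow> nat" where
  "next_worker A k g = fst (snd (decision A k g))"

definition point :: "algorithm \<Rightarrow> nat \<Rightarrow> (nat \<Rightarrow> vector) \<Rightarrow> vector" where
  "point A k g = snd (snd (decision A k g))"

fun wallclock :: "algorithm \<Rightarrow> nat \<Rightarrow> (nat \<Rightarrow> vector) \<Rightarrow> real" where
  "wallclock A 0 g = 0"
| "wallclock A (Suc k) g = fst (decision A k g)"

text \<open>
  Measurability is what makes the iterates random variables. The target space also forces
  the selected worker to lie in {1, ..., n} and the point to lie in the d-dimensional space.
\<close>

definition async_algorithm :: "nat \<Rightarrow> nat \<Rightarrow> algorithm \<Rightarrow> bool" where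
  "async_algorithm d n A \<longleftrightarrow>
     (\<forall>k. A k \<in> (\<Pi>\<^sub>M j\<in>{1..k}. borel_Rd d) \<rightarrow>\<^sub>M (borel \<Otimes>\<^sub>M (count_space {1..n} \<Otimes>\<^sub>M borel_Rd d))) \<and>
     (\<forall>k. \<forall>g\<in>space (\<Pi>\<^sub>M j\<in>{1..k}. borel_Rd d).
        wallclock A k g \<le> wallclock A (Suc k) g \<and>
        supp (point A k g) \<subseteq> (\<Union>s\<in>{1..k}. supp (g s)))"

text \<open>
  History and worker states after k calls, where call k draws the sample \<omega> k.
  A call that returns no gradient ignores its sample. History entries outside
  {1, ..., k} are never read.
\<close>

primrec run ::
  "(vector \<Rightarrow> real \<Rightarrow> vector) \<Rightarrow> (nat \<Rightarrow> real) \<Rightarrow> algorithm \<Rightarrow> (nat \<Rightarrow> real) \<Rightarrow> nat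
     \<Rightarrow> (nat \<Rightarrow> vector) \<times> (nat \<Rightarrow> worker_state)" where
  "run G \<tau> A \<omega> 0 = ((\<lambda>_. zero_vec), (\<lambda>_. idle))"
| "run G \<tau> A \<omega> (Suc k) =
     (let (g, s) = run G \<tau> A \<omega> k;
          i = next_worker A k g;
          (s', v) = sfo_oracle G (\<tau> i) (wallclock A (Suc k) g) (point A k g) (s i) (\<omega> (Suc k))
      in (g(Suc k := v), s(i := s')))"

definition iterate ::
  "(vector \<Rightarrow> real \<Rightarrow> vector) \<Rightarrow> (nat \<Rightarrow> real) \<Rightarrow> algorithm \<Rightarrow> nat \<Rightarrow> (nat \<Rightarrow> real) \<Rightarrow> vector" where
  "iterate G \<tau> A k \<omega> = point A k (fst (run G \<tau> A \<omega> k))"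

definition call_time ::
  "(vector \<Rightarrow> real \<Rightarrow> vector) \<Rightarrow> (nat \<Rightarrow> real) \<Rightarrow> algorithm \<Rightarrow> nat \<Rightarrow> (nat \<Rightarrow> real) \<Rightarrow> real" where
  "call_time G \<tau> A k \<omega> = wallclock A k (fst (run G \<tau> A \<omega> k))"

text \<open>
  The times t k are random, so which iterates are available by time t depends on the sample.
  Accordingly, a candidate is a random point that almost surely is one of the available iterates.
\<close>

definition stationary_found_by ::
  "nat \<Rightarrow> (vector \<Rightarrow> vector) \<Rightarrow> real measure \<Rightarrow> (vector \<Rightarrow> real \<Rightarrow> vector) \<Rightarrow> (nat \<Rightarrow> real)
     \<Rightarrow> algorithm \<Rightarrow> real \<Rightarrow> real \<Rightarrow> bool" where
  "stationary_found_by d gradf D G \<tau> A \<epsilon> t \<longleftrightarrow>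
     (let M = (\<Pi>\<^sub>M k\<in>UNIV. D) in
      \<exists>xhat \<in> M \<rightarrow>\<^sub>M borel_Rd d.
        (AE \<omega> in M. xhat \<omega> \<in> {iterate G \<tau> A k \<omega> | k. call_time G \<tau> A k \<omega> \<le> t}) \<and>
        (\<integral>\<^sup>+\<omega>. ennreal (norm_Rd d (gradf (xhat \<omega>))) \<partial>M) \<le> ennreal \<epsilon>)"

text \<open>The infimum is \<open>\<infinity>\<close> if no such point is ever available.\<close>

definition time_complexity ::
  "nat \<Rightarrow> (vector \<Rightarrow> vector) \<Rightarrow> real measure \<Rightarrow> (vector \<Rightarrow> real \<Rightarrow> vector) \<Rightarrow> (nat \<Rightarrow> real)
     \<Rightarrow> algorithm \<Rightarrow> real \<Rightarrow> ereal" where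
  "time_complexity d gradf D G \<tau> A \<epsilon> =
     (INF t\<in>{t. 0 \<le> t \<and> stationary_found_by d gradf D G \<tau> A \<epsilon> t}. ereal t)"

text \<open>
  The m-th term of the lower bound refers to the m fastest workers. Therefore
  \<open>ordered_time n \<tau> i\<close> is the i-th smallest of \<tau> 1, ..., \<tau> n.
\<close>

definition ordered_time :: "nat \<Rightarrow> (nat \<Rightarrow> real) \<Rightarrow> nat \<Rightarrow> real" where
  "ordered_time n \<tau> i = sort (map \<tau> [1..<Suc n]) ! (i - 1)"

lemma ordered_time_eq:
  assumes "mono_on {1..n} \<tau>" and "i \<in> {1..n}"
  shows "ordered_time n \<tau> i = \<tau> i"
proof -
  have "sorted (map \<tau> [1..<Suc n])"
    using assms(1) by (auto simp del: upt_Suc simp: sorted_iff_nth_mono intro!: mono_onD[of "{1..n}"])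
  then have "sort (map \<tau> [1..<Suc n]) = map \<tau> [1..<Suc n]"
    by (rule sort_key_id_if_sorted[where f = "\<lambda>x. x", simplified])
  then show ?thesis
    using assms(2) by (simp del: upt_Suc add: ordered_time_def, subst nth_map, simp_all del: upt_Suc, linarith)
qed

text \<open>The support condition in round 0 fixes the initial point.\<close>

lemma initial_point_eq_zero:
  assumes "async_algorithm d n A"
  shows "iterate G \<tau> A 0 \<omega> = zero_vec"
proof -
  have "supp (point A 0 (\<lambda>_. undefined)) \<subseteq> {}"
    using assms[unfolded async_algorithm_def, THEN conjunct2, rule_format, of "\<lambda>_. undefined" 0]
    by (simp add: space_PiM)
  moreover have "point A 0 g = point A 0 (\<lambda>_. undefined)" for g
    by (simp add: point_def decision_def restrict_def)
  ultimately have "supp (iterate G \<tau> A 0 \<omega>) \<subseteq> {}"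
    by (metis iterate_def)
  then show ?thesis
    by (simp add: supp_def fun_eq_iff)
qed

definition lower_bound_expr ::
  "real \<Rightarrow> real \<Rightarrow> real \<Rightarrow> real \<Rightarrow> real \<Rightarrow> nat \<Rightarrow> (nat \<Rightarrow> real) \<Rightarrow> real" where
  "lower_bound_expr L \<Delta> p \<sigma> \<epsilon> n \<tau> =
     (MIN m\<in>{1..n}. inverse ((1 / real m) * (\<Sum>i=1..m. 1 / ordered_time n \<tau> i)) *
        (L * \<Delta> / \<epsilon>^2 +
         L * \<sigma> powr (p / (p - 1)) * \<Delta> / (real m * \<epsilon> powr ((3 * p - 2) / (p - 1)))))"

end

theory Submission
  imports Defs
begin

text \<open>
  The hard instance is a chain: a smooth nonconvex function of \<open>d\<close> coordinates, \<open>d\<close> of order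
  \<open>L * \<Delta> / \<epsilon>\<^sup>2\<close>, whose gradient has norm at least \<open>2 * \<epsilon>\<close> wherever the last coordinate is 0
  (\<open>hard_grad_large\<close>), while the gradient at a point supported on the first \<open>l\<close> coordinates is
  supported on the first \<open>l + 1\<close> (\<open>hard_grad_zero_beyond\<close>). An algorithm whose points stay in the
  support of the returned vectors therefore has to reveal the coordinates one after the other. The
  stochastic oracle shows the new coordinate only with probability \<open>q\<close>, scaled by \<open>1 / q\<close> to stay
  unbiased. The bound \<open>\<sigma>\<close> on the \<open>p\<close>-th moment allows \<open>q\<close> to be as small as \<open>1 / B\<close> with \<open>B\<close> of order
  \<open>(\<sigma> / \<epsilon>)\<^bsup>p/(p-1)\<^esup>\<close> (\<open>stochastic_gradient_frontier_oracle\<close>).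

  A new coordinate needs a computation that was started after the previous coordinate had become
  known. Let \<open>t\<close> be a quarter of the minimum over \<open>m\<close> of
  \<open>(m + B) / (1 / \<tau>\<^sub>1 + \<dots> + 1 / \<tau>\<^sub>m)\<close>, for workers sorted by speed. Within time \<open>t\<close> the workers that
  can finish at all return at most \<open>B / 3\<close> gradients (\<open>fast_rate_le\<close>), so that a success within time
  \<open>t\<close> is unlikely and \<open>d\<close> coordinates should take time of order \<open>d * t\<close>, which is the asserted bound.

  To make this rigorous, no attention is paid to the random times at which coordinates are revealed.
  Every success comes either from a slow worker, with \<open>\<tau> > t\<close>, or from a fast one. A slow success costs
  more than time \<open>t\<close>, so up to time \<open>d * t / 2\<close> there is room for fewer than \<open>d / 2\<close> of them
  to reveal coordinates one after the other. The fast workers return at most \<open>d * B / 6\<close> gradients in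
  that time altogether, no matter how the algorithm schedules them, and since a sample is independent
  of the decision to use it, their expected number of successes is at most \<open>d / 6\<close>
  (\<open>expected_fast_successes_le\<close>). A single invariant of the run (\<open>progress_bound\<close>) combines the two
  kinds of successes, and a pointwise inequality turns the expected number into a lower bound for the
  expected gradient norm (\<open>not_stationary_found_by\<close>).
\<close>

section \<open>One-dimensional gate and ramp\<close>

text \<open>
  The link between consecutive coordinates of the chain is the product of a gate in the earlier
  coordinate and a ramp in the later one. Taking both to be polynomials in \<open>tanh\<close> makes all bounds
  and Lipschitz constants follow from \<open>\<bar>tanh\<bar> \<le> 1\<close> and \<open>tanh' = 1 - tanh\<^sup>2\<close>. The exponent 3 serves two
  purposes: the gate and its derivative vanish at 0, so that a coordinate equal to 0 hides all later
  ones, and the gate is nondecreasing on the whole line, so that the pull which it exerts on its own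
  coordinate never opposes the pull of a ramp whose gate is open.
\<close>

definition gate :: "real \<Rightarrow> real" where
  "gate t = tanh t ^ 3"

definition gate' :: "real \<Rightarrow> real" where
  "gate' t = 3 * tanh t ^ 2 * (1 - tanh t ^ 2)"

definition ramp :: "real \<Rightarrow> real" where
  "ramp t = 1 + tanh t"

definition ramp' :: "real \<Rightarrow> real" where
  "ramp' t = 1 - tanh t ^ 2"

lemma abs_mult_le:
  fixes a b :: real
  assumes "\<bar>a\<bar> \<le> A" and "\<bar>b\<bar> \<le> B"
  shows "\<bar>a * b\<bar> \<le> A * B"
  unfolding abs_mult using assms by (intro mult_mono) auto

lemma abs_tanh_le_1: "\<bar>tanh (t::real)\<bar> \<le> 1"
  using tanh_real_bounds[of t] by auto

lemma tanh_square_le_1: "tanh (t::real) ^ 2 \<le> 1"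
  using abs_tanh_le_1[of t] by (simp add: abs_square_le_1)

lemma DERIV_tanh: "(tanh has_real_derivative 1 - tanh t ^ 2) (at t)"
  by (auto intro!: derivative_eq_intros)

lemma abs_diff_le_of_deriv_bound:
  fixes h h' :: "real \<Rightarrow> real"
  assumes "\<And>t. (h has_real_derivative h' t) (at t)" and "\<And>t. \<bar>h' t\<bar> \<le> M"
  shows "\<bar>h s - h t\<bar> \<le> M * \<bar>s - t\<bar>"
  using field_differentiable_bound[of UNIV h h' M s t] assms by simp

text \<open>
  The mean value inequality for \<open>u \<mapsto> h u - h' t * u\<close>, whose derivative is at most \<open>M * \<bar>s - t\<bar>\<close> between
  \<open>t\<close> and \<open>s\<close>, costs a factor 2 against the optimal constant but needs no integration.
\<close>

lemma taylor_remainder_of_lipschitz_deriv: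
  fixes h h' :: "real \<Rightarrow> real"
  assumes deriv: "\<And>t. (h has_real_derivative h' t) (at t)"
    and lip: "\<And>s t. \<bar>h' s - h' t\<bar> \<le> M * \<bar>s - t\<bar>"
  shows "\<bar>h s - h t - h' t * (s - t)\<bar> \<le> M * (s - t)^2"
proof -
  have "0 \<le> M"
    using lip[of 0 1] by (smt (verit) abs_ge_zero mult_cancel_left1)
  have "norm ((h s - h' t * s) - (h t - h' t * t)) \<le> (M * \<bar>s - t\<bar>) * norm (s - t)"
  proof (rule field_differentiable_bound[where S = "closed_segment t s" and f' = "\<lambda>u. h' u - h' t"])
    fix u assume u: "u \<in> closed_segment t s"
    show "((\<lambda>u. h u - h' t * u) has_field_derivative h' u - h' t) (at u within closed_segment t s)"
      by (auto intro!: derivative_eq_intros DERIV_subset[OF deriv])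
    have "\<bar>u - t\<bar> \<le> \<bar>s - t\<bar>"
      using u by (auto simp: closed_segment_eq_real_ivl split: if_splits)
    then show "norm (h' u - h' t) \<le> M * \<bar>s - t\<bar>"
      using lip[of u t] \<open>0 \<le> M\<close> by (smt (verit) mult_left_mono real_norm_def)
  qed auto
  then show ?thesis
    by (simp add: algebra_simps power2_eq_square abs_mult_self_eq)
qed

lemma tanh_lipschitz: "\<bar>tanh s - tanh t\<bar> \<le> \<bar>s - t\<bar>" for s t :: real
  using abs_diff_le_of_deriv_bound[OF DERIV_tanh, of 1 s t] tanh_square_le_1 by simp

lemma DERIV_gate: "(gate has_real_derivative gate' t) (at t)"
  unfolding gate_def gate'_def by (auto intro!: derivative_eq_intros)

lemma DERIV_ramp: "(ramp has_real_derivative ramp' t) (at t)"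
  unfolding ramp_def ramp'_def by (auto intro!: derivative_eq_intros)

lemma abs_gate_le_1: "\<bar>gate t\<bar> \<le> 1"
  using abs_tanh_le_1[of t] by (simp add: gate_def power_abs power_le_one)

lemma gate'_bounds: "0 \<le> gate' t" "gate' t \<le> 3"
proof -
  show "0 \<le> gate' t"
    using tanh_square_le_1[of t] by (simp add: gate'_def)
  have "tanh t ^ 2 * (1 - tanh t ^ 2) \<le> 1 * 1"
    using tanh_square_le_1[of t] by (intro mult_mono) auto
  then show "gate' t \<le> 3"
    by (simp add: gate'_def)
qed

lemma ramp_bounds: "0 \<le> ramp t" "ramp t \<le> 2"
  using abs_tanh_le_1[of t] by (auto simp: ramp_def)

lemma ramp'_bounds: "0 \<le> ramp' t" "ramp' t \<le> 1"
  using tanh_square_le_1[of t] by (auto simp: ramp'_def)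

lemma square_lipschitz_on_unit: "\<bar>u^2 - v^2\<bar> \<le> 2 * \<bar>u - v\<bar>"
  if "\<bar>u\<bar> \<le> 1" "\<bar>v\<bar> \<le> 1" for u v :: real
proof -
  have "\<bar>u^2 - v^2\<bar> = \<bar>u + v\<bar> * \<bar>u - v\<bar>"
    by (simp add: abs_mult[symmetric] power2_eq_square algebra_simps)
  then show ?thesis
    using that by (auto intro!: mult_right_mono)
qed

lemma gate_lipschitz: "\<bar>gate s - gate t\<bar> \<le> 3 * \<bar>s - t\<bar>"
  using gate'_bounds
  by (intro abs_diff_le_of_deriv_bound[OF DERIV_gate]) (simp add: abs_le_iff order_trans[of _ 0])

lemma ramp_lipschitz: "\<bar>ramp s - ramp t\<bar> \<le> \<bar>s - t\<bar>"
  using tanh_lipschitz by (simp add: ramp_def)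

lemma ramp'_lipschitz: "\<bar>ramp' s - ramp' t\<bar> \<le> 2 * \<bar>s - t\<bar>"
  using square_lipschitz_on_unit[OF abs_tanh_le_1 abs_tanh_le_1, of t s] tanh_lipschitz[of s t]
  by (simp add: ramp'_def abs_minus_commute)

lemma gate'_lipschitz: "\<bar>gate' s - gate' t\<bar> \<le> 18 * \<bar>s - t\<bar>"
proof -
  let ?u = "tanh s ^ 2" and ?v = "tanh t ^ 2"
  have sq: "\<bar>?u - ?v\<bar> \<le> 2 * \<bar>s - t\<bar>"
    using square_lipschitz_on_unit[OF abs_tanh_le_1 abs_tanh_le_1, of s t] tanh_lipschitz[of s t]
    by simp
  have "3 * u * (1 - u) - 3 * v * (1 - v) = 3 * ((u - v) * (1 - u - v))" for u v :: real
    by (simp add: algebra_simps)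
  then have "\<bar>gate' s - gate' t\<bar> = 3 * \<bar>(?u - ?v) * (1 - ?u - ?v)\<bar>"
    by (simp add: gate'_def abs_mult)
  moreover have "\<bar>(?u - ?v) * (1 - ?u - ?v)\<bar> \<le> 2 * \<bar>s - t\<bar> * 3"
    using tanh_square_le_1[of s] tanh_square_le_1[of t] zero_le_power2[of "tanh s"]
      zero_le_power2[of "tanh t"]
    by (intro abs_mult_le sq) linarith
  ultimately show ?thesis by simp
qed

section \<open>The chain\<close>

text \<open>
  The input of the gate at the first coordinate is replaced by the constant 1, so that the chain
  always has a first coordinate to pull up.
\<close>

definition gate_in :: "vector \<Rightarrow> nat \<Rightarrow> real" where
  "gate_in x i = (if i = 0 then 1 else gate (x (i - 1)))"

text \<open>
  The quadratic term keeps the coordinates from escaping to minus infinity, where the ramp is flat: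
  there it dominates and forces a large gradient. On the range where the ramp is steep its weight
  1/64 is too small to cancel the ramp.
\<close>

definition chain :: "nat \<Rightarrow> vector \<Rightarrow> real" where
  "chain d x = (\<Sum>i<d. (x i)^2 / 64 - gate_in x i * ramp (x i))"

definition chain_grad :: "nat \<Rightarrow> vector \<Rightarrow> vector" where
  "chain_grad d x i = (if i < d
     then x i / 32 - gate_in x i * ramp' (x i)
       - (if Suc i < d then gate' (x i) * ramp (x (Suc i)) else 0)
     else 0)"

lemma abs_gate_in_le_1: "\<bar>gate_in x i\<bar> \<le> 1"
  by (simp add: gate_in_def abs_gate_le_1)

text \<open>
  A coordinate of the chain interacts with its two neighbours. The next three facts compare sums over
  shifted indices with sums over all of them.
\<close>

lemma sum_prev_le:
  fixes a :: "nat \<Rightarrow> real"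
  assumes "\<And>i. 0 \<le> a i"
  shows "(\<Sum>i<d. if i = 0 then 0 else a (i - 1)) \<le> (\<Sum>i<d. a i)"
proof (cases d)
  case (Suc m)
  have "(\<Sum>i<Suc m. if i = 0 then 0 else a (i - 1)) = (\<Sum>i<m. a i)"
    by (subst sum.lessThan_Suc_shift) simp
  then show ?thesis using Suc assms by simp
qed simp

lemma sum_next_eq_sum_prev:
  fixes a :: "nat \<Rightarrow> real"
  shows "(\<Sum>i<d. if Suc i < d then a i else 0) = (\<Sum>i<d. if i = 0 then 0 else a (i - 1))"
proof (cases d)
  case (Suc m)
  have "(\<Sum>i<Suc m. if i = 0 then 0 else a (i - 1)) = (\<Sum>i<m. a i)"
    by (subst sum.lessThan_Suc_shift) simp
  then show ?thesis using Suc by simp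
qed simp

lemma sum_next_le:
  fixes a :: "nat \<Rightarrow> real"
  assumes "\<And>i. 0 \<le> a i"
  shows "(\<Sum>i<d. if Suc i < d then a (Suc i) else 0) \<le> (\<Sum>i<d. a i)"
proof (cases d)
  case (Suc m)
  have "(\<Sum>i<Suc m. if Suc i < Suc m then a (Suc i) else 0) = (\<Sum>i<m. a (Suc i))"
    by simp
  also have "\<dots> \<le> (\<Sum>i<Suc m. a i)"
    using assms[of 0] by (simp only: sum.lessThan_Suc_shift)
  finally show ?thesis using Suc by simp
qed simp

text \<open>
  Coordinate \<open>i\<close> of the gradient depends only on the coordinates \<open>i - 1\<close>, \<open>i\<close>, \<open>i + 1\<close>, through products of
  bounded Lipschitz functions. Hence the constant does not depend on the length of the chain: it is
  the sum of the three constants 3, 39, 3.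
\<close>

lemma chain_grad_lipschitz:
  "dist_Rd d (chain_grad d x) (chain_grad d y) \<le> 45 * dist_Rd d x y"
proof -
  define D where "D i = \<bar>x i - y i\<bar>" for i
  define P where "P i = (if i = 0 then 0 else D (i - 1))" for i
  define N where "N i = (if Suc i < d then D (Suc i) else 0)" for i
  have nonneg: "0 \<le> D i" "0 \<le> P i" "0 \<le> N i" for i
    by (auto simp: D_def P_def N_def)
  have LP: "L2_set P {..<d} \<le> L2_set D {..<d}"
  proof -
    have "(\<Sum>i<d. (P i)^2) = (\<Sum>i<d. if i = 0 then 0 else (D (i - 1))^2)"
      by (intro sum.cong) (auto simp: P_def)
    then show ?thesis
      using sum_prev_le[of "\<lambda>i. (D i)^2" d] by (simp add: L2_set_def)
  qed
  have LN: "L2_set N {..<d} \<le> L2_set D {..<d}"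
  proof -
    have "(\<Sum>i<d. (N i)^2) = (\<Sum>i<d. if Suc i < d then (D (Suc i))^2 else 0)"
      by (intro sum.cong) (auto simp: N_def)
    then show ?thesis
      using sum_next_le[of "\<lambda>i. (D i)^2" d] by (simp add: L2_set_def)
  qed
  have LD: "L2_set D {..<d} = dist_Rd d x y"
    by (simp add: D_def dist_Rd_def norm_Rd_def L2_set_def)
  have coord: "\<bar>chain_grad d x i - chain_grad d y i\<bar> \<le> 3 * P i + (39 * D i + 3 * N i)" if "i < d" for i
  proof -
    have in_lip: "\<bar>gate_in x i - gate_in y i\<bar> \<le> 3 * P i"
      using gate_lipschitz by (auto simp: gate_in_def P_def D_def)
    have "\<bar>gate_in x i * ramp' (x i) - gate_in y i * ramp' (y i)\<bar>
        = \<bar>gate_in x i * (ramp' (x i) - ramp' (y i)) + (gate_in x i - gate_in y i) * ramp' (y i)\<bar>"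
      by (simp add: algebra_simps)
    also have "\<dots> \<le> 1 * (2 * D i) + 3 * P i * 1"
      using ramp'_lipschitz[of "x i" "y i"] abs_gate_in_le_1[of x i] in_lip ramp'_bounds[of "y i"]
      by (intro order_trans[OF abs_triangle_ineq] add_mono abs_mult_le) (auto simp: D_def)
    finally have A: "\<bar>gate_in x i * ramp' (x i) - gate_in y i * ramp' (y i)\<bar> \<le> 2 * D i + 3 * P i"
      by simp
    define nx where "nx z = (if Suc i < d then gate' (z i) * ramp (z (Suc i)) else 0)" for z :: vector
    have B: "\<bar>nx x - nx y\<bar> \<le> 36 * D i + 3 * N i"
    proof (cases "Suc i < d")
      case True
      have "\<bar>nx x - nx y\<bar>
          = \<bar>(gate' (x i) - gate' (y i)) * ramp (x (Suc i))
            + gate' (y i) * (ramp (x (Suc i)) - ramp (y (Suc i)))\<bar>"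
        using True by (simp add: nx_def algebra_simps)
      also have "\<dots> \<le> 18 * D i * 2 + 3 * D (Suc i)"
        using gate'_lipschitz[of "x i" "y i"] ramp_bounds[of "x (Suc i)"] gate'_bounds[of "y i"]
          ramp_lipschitz[of "x (Suc i)" "y (Suc i)"]
        by (intro order_trans[OF abs_triangle_ineq] add_mono abs_mult_le) (auto simp: D_def)
      finally show ?thesis using True by (simp add: N_def)
    qed (use nonneg in \<open>simp add: nx_def\<close>)
    have "chain_grad d x i - chain_grad d y i = (x i - y i) / 32
        - (gate_in x i * ramp' (x i) - gate_in y i * ramp' (y i)) - (nx x - nx y)"
      using that by (simp add: chain_grad_def nx_def diff_divide_distrib)
    moreover have "\<bar>(x i - y i) / 32\<bar> \<le> D i"
      by (simp add: D_def)
    ultimately show ?thesis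
      using A B nonneg(1)[of i] by linarith
  qed
  have "dist_Rd d (chain_grad d x) (chain_grad d y)
      = L2_set (\<lambda>i. \<bar>chain_grad d x i - chain_grad d y i\<bar>) {..<d}"
    by (simp add: dist_Rd_def norm_Rd_def L2_set_def)
  also have "\<dots> \<le> L2_set (\<lambda>i. 3 * P i + (39 * D i + 3 * N i)) {..<d}"
    using coord by (intro L2_set_mono) auto
  also have "\<dots> \<le> L2_set (\<lambda>i. 3 * P i) {..<d}
      + (L2_set (\<lambda>i. 39 * D i) {..<d} + L2_set (\<lambda>i. 3 * N i) {..<d})"
    by (intro order_trans[OF L2_set_triangle_ineq] add_mono order_refl)
  also have "\<dots> \<le> 45 * L2_set D {..<d}"
    using LP LN by (simp add: L2_set_right_distrib[symmetric])
  finally show ?thesis by (simp add: LD)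
qed

text \<open>
  Each summand is expanded separately, with the first order Taylor remainders of gate and ramp. The
  derivative of a summand with respect to the earlier of its coordinates is then moved to that
  coordinate by shifting the summation index.
\<close>

lemma chain_quadratic_remainder:
  "\<bar>chain d y - chain d x - (\<Sum>i<d. chain_grad d x i * (y i - x i))\<bar> \<le> 43 * (dist_Rd d y x)^2"
proof -
  define D where "D i = y i - x i" for i
  define P where "P i = (if i = 0 then 0 else D (i - 1))" for i
  define summand where "summand z i = (z i)^2 / 64 - gate_in z i * ramp (z i)" for z :: vector and i
  define lin where "lin i = (x i / 32 - gate_in x i * ramp' (x i)) * D i
      - (if i = 0 then 0 else gate' (x (i - 1)) * D (i - 1) * ramp (x i))" for i
  have "(\<Sum>i<d. chain_grad d x i * (y i - x i))
      = (\<Sum>i<d. (x i / 32 - gate_in x i * ramp' (x i)) * D i)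
        - (\<Sum>i<d. if Suc i < d then gate' (x i) * D i * ramp (x (Suc i)) else 0)"
    unfolding sum_subtractf[symmetric]
    by (intro sum.cong) (auto simp: chain_grad_def D_def algebra_simps)
  also have "(\<Sum>i<d. if Suc i < d then gate' (x i) * D i * ramp (x (Suc i)) else 0)
      = (\<Sum>i<d. if i = 0 then 0 else gate' (x (i - 1)) * D (i - 1) * ramp (x i))"
    by (subst sum_next_eq_sum_prev, intro sum.cong) auto
  finally have lin: "(\<Sum>i<d. chain_grad d x i * (y i - x i)) = (\<Sum>i<d. lin i)"
    by (simp add: lin_def sum_subtractf)
  have "\<bar>summand y i - summand x i - lin i\<bar> \<le> 5 * (D i)^2 + 38 * (P i)^2" for i
  proof -
    define g where "g = (if i = 0 then 0 else gate' (x (i - 1)) * D (i - 1))"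
    have grem: "\<bar>gate_in y i - gate_in x i - g\<bar> \<le> 18 * (P i)^2"
      using taylor_remainder_of_lipschitz_deriv[OF DERIV_gate gate'_lipschitz]
      by (auto simp: gate_in_def g_def P_def D_def)
    have gdiff: "\<bar>gate_in y i - gate_in x i\<bar> \<le> 3 * \<bar>P i\<bar>"
      using gate_lipschitz by (auto simp: gate_in_def P_def D_def)
    have rrem: "\<bar>ramp (y i) - ramp (x i) - ramp' (x i) * D i\<bar> \<le> 2 * (D i)^2"
      using taylor_remainder_of_lipschitz_deriv[OF DERIV_ramp ramp'_lipschitz] by (simp add: D_def)
    have "summand y i - summand x i - lin i = (D i)^2 / 64
        - (gate_in y i * (ramp (y i) - ramp (x i) - ramp' (x i) * D i)
          + ((gate_in y i - gate_in x i) * (ramp' (x i) * D i)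
          + (gate_in y i - gate_in x i - g) * ramp (x i)))"
      by (simp add: summand_def lin_def g_def D_def field_simps power2_eq_square)
    moreover have "\<bar>gate_in y i * (ramp (y i) - ramp (x i) - ramp' (x i) * D i)\<bar> \<le> 1 * (2 * (D i)^2)"
      using abs_gate_in_le_1[of y i] rrem by (intro abs_mult_le)
    moreover have "\<bar>(gate_in y i - gate_in x i) * (ramp' (x i) * D i)\<bar> \<le> 3 * \<bar>P i\<bar> * (1 * \<bar>D i\<bar>)"
      using gdiff ramp'_bounds[of "x i"] by (intro abs_mult_le) auto
    moreover have "\<bar>(gate_in y i - gate_in x i - g) * ramp (x i)\<bar> \<le> 18 * (P i)^2 * 2"
      using grem ramp_bounds[of "x i"] by (intro abs_mult_le) auto
    moreover have "3 * \<bar>P i\<bar> * (1 * \<bar>D i\<bar>) \<le> 2 * (P i)^2 + 2 * (D i)^2"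
      using sum_squares_bound[of "\<bar>P i\<bar>" "\<bar>D i\<bar>"] zero_le_power2[of "P i"]
        zero_le_power2[of "D i"] by (simp only: power2_abs mult_1)
    ultimately show ?thesis
      using zero_le_power2[of "D i"] unfolding abs_le_iff by linarith
  qed
  then have "\<bar>\<Sum>i<d. summand y i - summand x i - lin i\<bar> \<le> (\<Sum>i<d. 5 * (D i)^2 + 38 * (P i)^2)"
    by (intro order_trans[OF sum_abs] sum_mono)
  also have "\<dots> = 5 * (\<Sum>i<d. (D i)^2) + 38 * (\<Sum>i<d. (P i)^2)"
    by (simp add: sum.distrib sum_distrib_left)
  also have "\<dots> \<le> 43 * (\<Sum>i<d. (D i)^2)"
  proof -
    have "(\<Sum>i<d. (P i)^2) = (\<Sum>i<d. if i = 0 then 0 else (D (i - 1))^2)"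
      by (intro sum.cong) (auto simp: P_def)
    then show ?thesis
      using sum_prev_le[of "\<lambda>i. (D i)^2" d] by simp
  qed
  also have "(\<Sum>i<d. (D i)^2) = (dist_Rd d y x)^2"
    by (simp add: dist_Rd_def norm_Rd_def L2_set_def D_def sum_nonneg)
  finally show ?thesis
    by (simp add: chain_def lin summand_def sum_subtractf)
qed

lemma chain_lower_bound: "- 2 * real d \<le> chain d x"
proof -
  have "(\<Sum>i<d. - 2) \<le> chain d x"
    unfolding chain_def
  proof (rule sum_mono)
    fix i
    have "gate_in x i * ramp (x i) \<le> 1 * 2"
      using abs_gate_in_le_1[of x i] ramp_bounds[of "x i"] by (intro mult_mono) auto
    then show "- 2 \<le> (x i)^2 / 64 - gate_in x i * ramp (x i)"
      by (smt (verit) zero_le_power2 divide_nonneg_nonneg)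
  qed
  then show ?thesis by simp
qed

lemma chain_zero_nonpos: "chain d zero_vec \<le> 0"
  unfolding chain_def by (intro sum_nonpos) (auto simp: gate_in_def gate_def ramp_def)

lemma tanh_1_ge_half: "1 / 2 \<le> tanh (1::real)"
proof -
  have "3 \<le> exp (2::real)"
    using exp_ge_add_one_self[of "2::real"] by simp
  then show ?thesis
    by (simp add: tanh_real_altdef exp_minus divide_simps)
qed

text \<open>
  The coordinate that carries the large derivative is the first one whose \<open>tanh\<close> is below 1/2: its gate
  is open, because the coordinate before it is beyond that threshold. All contributions to the
  derivative there are nonpositive, except for a positive coordinate in the quadratic term. If the
  coordinate is moderate, the open gate times the slope of the ramp wins; if it is very negative, the
  quadratic term does.
\<close>

lemma chain_grad_large:
  assumes "0 < d" and "x (d - 1) = 0"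
  shows "\<exists>i<d. 1 / 64 \<le> \<bar>chain_grad d x i\<bar>"
proof -
  define i where "i = (LEAST i. tanh (x i) < 1 / 2)"
  have last: "tanh (x (d - 1)) < 1 / 2"
    using assms by simp
  have low: "tanh (x i) < 1 / 2"
    unfolding i_def using last by (rule LeastI)
  have "i < d"
    using Least_le[of "\<lambda>i. tanh (x i) < 1 / 2", OF last] assms(1) by (simp add: i_def)
  have gate: "1 / 8 \<le> gate_in x i"
  proof (cases "i = 0")
    case False
    then have "1 / 2 \<le> tanh (x (i - 1))"
      using not_less_Least[of "i - 1" "\<lambda>i. tanh (x i) < 1 / 2"]
      unfolding i_def[symmetric] by linarith
    then have "(1 / 2) ^ 3 \<le> tanh (x (i - 1)) ^ 3"
      by (intro power_mono) auto
    then show ?thesis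
      using False by (simp add: gate_in_def gate_def power_divide)
  qed (simp add: gate_in_def)
  have pull: "0 \<le> (if Suc i < d then gate' (x i) * ramp (x (Suc i)) else 0)"
    using gate'_bounds ramp_bounds by simp
  have "x i / 32 - gate_in x i * ramp' (x i) \<le> - 1 / 64"
  proof (cases "- 1 / 2 \<le> tanh (x i)")
    case True
    have "\<bar>tanh (x i)\<bar> \<le> 1 / 2"
      using True low by simp
    then have "tanh (x i) ^ 2 \<le> (1 / 2) ^ 2"
      by (metis abs_ge_zero power2_abs power_mono)
    then have "1 / 8 * (3 / 4) \<le> gate_in x i * ramp' (x i)"
      using gate by (intro mult_mono) (auto simp: ramp'_def power_divide)
    moreover have "x i < 1"
      using low tanh_1_ge_half by (metis order_less_le_trans tanh_real_less_iff)
    ultimately show ?thesis by simp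
  next
    case False
    then have "tanh (x i) < 0" by linarith
    then have "x i < 0" by simp
    have "\<bar>tanh (x i)\<bar> \<le> \<bar>x i\<bar>"
      using tanh_lipschitz[of "x i" 0] by simp
    then have "x i \<le> - 1 / 2"
      using False \<open>x i < 0\<close> by simp
    moreover have "0 \<le> gate_in x i * ramp' (x i)"
      using gate ramp'_bounds[of "x i"] by simp
    ultimately show ?thesis by simp
  qed
  then have "chain_grad d x i \<le> - 1 / 64"
    using pull \<open>i < d\<close> by (simp add: chain_grad_def)
  then show ?thesis
    using \<open>i < d\<close> by (intro exI[of _ i]) auto
qed

text \<open>
  The zero-chain property: one exact gradient extends the support by one coordinate at most.
\<close>

lemma chain_grad_zero_beyond:
  assumes "supp x \<subseteq> {..<l}" and "l < i"
  shows "chain_grad d x i = 0"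
proof -
  have "x i = 0" "x (i - 1) = 0"
    using assms by (auto simp: supp_def)
  then show ?thesis
    using assms(2) by (simp add: chain_grad_def gate_in_def gate_def gate'_def)
qed

lemma chain_grad_frontier_le_1:
  assumes "supp x \<subseteq> {..<l}"
  shows "\<bar>chain_grad d x l\<bar> \<le> 1"
proof -
  have "x l = 0"
    using assms by (auto simp: supp_def)
  then show ?thesis
    using abs_gate_in_le_1[of x l] by (simp add: chain_grad_def gate'_def ramp'_def)
qed

section \<open>Rescaled hard functions\<close>

lemma Rd_iff: "x \<in> Rd d \<longleftrightarrow> (\<forall>i\<ge>d. x i = 0)"
  by (simp add: topspace_Euclidean_space)

lemma norm_Rd_scale: "norm_Rd d (\<lambda>j. c * v j) = \<bar>c\<bar> * norm_Rd d v"
  by (simp add: norm_Rd_def L2_set_def power_mult_distrib sum_distrib_left[symmetric] real_sqrt_mult)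

lemma dist_Rd_scale: "dist_Rd d (\<lambda>j. c * x j) (\<lambda>j. c * y j) = \<bar>c\<bar> * dist_Rd d x y"
  using norm_Rd_scale[of d c "\<lambda>j. x j - y j"] by (simp add: dist_Rd_def right_diff_distrib)

lemma dist_Rd_nonneg: "0 \<le> dist_Rd d x y"
  by (simp add: dist_Rd_def norm_Rd_def)

lemma abs_coordinate_le_norm_Rd: "i < d \<Longrightarrow> \<bar>v i\<bar> \<le> norm_Rd d v"
  using member_le_L2_set[of "{..<d}" i "\<lambda>i. \<bar>v i\<bar>"] by (simp add: norm_Rd_def L2_set_def)

lemma has_gradient_of_quadratic_remainder:
  assumes v: "v \<in> Rd d" and "0 \<le> C"
    and rem: "\<And>y. \<bar>f y - f x - (\<Sum>j<d. v j * (y j - x j))\<bar> \<le> C * (dist_Rd d y x)^2"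
  shows "has_gradient d f v x"
  unfolding has_gradient_def
proof (intro conjI v allI impI)
  fix e :: real assume "0 < e"
  show "\<exists>r>0. \<forall>y\<in>Rd d. dist_Rd d y x < r \<longrightarrow>
      \<bar>f y - f x - (\<Sum>j<d. v j * (y j - x j))\<bar> \<le> e * dist_Rd d y x"
  proof (intro exI[of _ "e / (C + 1)"] conjI ballI impI)
    show "0 < e / (C + 1)"
      using \<open>0 < e\<close> \<open>0 \<le> C\<close> by simp
    fix y assume "dist_Rd d y x < e / (C + 1)"
    then have "C * dist_Rd d y x \<le> e"
      using \<open>0 \<le> C\<close> dist_Rd_nonneg[of d y x] by (simp add: field_simps)
    then have "C * dist_Rd d y x * dist_Rd d y x \<le> e * dist_Rd d y x"
      by (intro mult_right_mono dist_Rd_nonneg)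
    then show "\<bar>f y - f x - (\<Sum>j<d. v j * (y j - x j))\<bar> \<le> e * dist_Rd d y x"
      using rem[of y] by (simp add: power2_eq_square)
  qed
qed

text \<open>
  The gradient is of order \<open>r\<close> and varies on the length scale \<open>s\<close>. The smoothness constant is therefore
  proportional to \<open>r / s\<close>, and each coordinate lets the function descend by a multiple of \<open>r * s\<close>.
\<close>

definition hard_fun :: "nat \<Rightarrow> real \<Rightarrow> real \<Rightarrow> vector \<Rightarrow> real" where
  "hard_fun d r s x = r * s * chain d (\<lambda>j. (1 / s) * x j)"

definition hard_grad :: "nat \<Rightarrow> real \<Rightarrow> real \<Rightarrow> vector \<Rightarrow> vector" where
  "hard_grad d r s x i = r * chain_grad d (\<lambda>j. (1 / s) * x j) i"

lemma hard_grad_in_Rd: "hard_grad d r s x \<in> Rd d"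
  by (simp add: Rd_iff hard_grad_def chain_grad_def)

lemma hard_fun_smooth:
  assumes "0 < r" and "0 < s"
  shows "L_smooth d (45 * r / s) (hard_fun d r s) (hard_grad d r s)"
  unfolding L_smooth_def
proof (intro conjI ballI)
  fix x :: vector
  let ?x = "\<lambda>j. (1 / s) * x j"
  show "has_gradient d (hard_fun d r s) (hard_grad d r s x) x"
  proof (rule has_gradient_of_quadratic_remainder[where C = "43 * r / s"])
    fix y :: vector
    let ?y = "\<lambda>j. (1 / s) * y j"
    have "(\<Sum>j<d. hard_grad d r s x j * (y j - x j))
        = r * s * (\<Sum>j<d. chain_grad d ?x j * (?y j - ?x j))"
      unfolding sum_distrib_left using assms
      by (intro sum.cong) (simp_all add: hard_grad_def field_simps)
    then have "\<bar>hard_fun d r s y - hard_fun d r s x - (\<Sum>j<d. hard_grad d r s x j * (y j - x j))\<bar>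
        = \<bar>r * s * (chain d ?y - chain d ?x - (\<Sum>j<d. chain_grad d ?x j * (?y j - ?x j)))\<bar>"
      by (simp add: hard_fun_def right_diff_distrib)
    also have "\<dots> = r * s * \<bar>chain d ?y - chain d ?x - (\<Sum>j<d. chain_grad d ?x j * (?y j - ?x j))\<bar>"
      using assms by (simp only: abs_mult)
    also have "\<dots> \<le> r * s * (43 * (dist_Rd d ?y ?x)^2)"
      using assms by (intro mult_left_mono chain_quadratic_remainder) auto
    also have "\<dots> = 43 * r / s * (dist_Rd d y x)^2"
      unfolding dist_Rd_scale using assms by (simp add: power2_eq_square)
    finally show "\<bar>hard_fun d r s y - hard_fun d r s x - (\<Sum>j<d. hard_grad d r s x j * (y j - x j))\<bar>
        \<le> 43 * r / s * (dist_Rd d y x)^2" .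
  qed (use assms in \<open>auto simp: hard_grad_in_Rd\<close>)
next
  fix x y :: vector
  let ?x = "\<lambda>j. (1 / s) * x j" and ?y = "\<lambda>j. (1 / s) * y j"
  have "dist_Rd d (hard_grad d r s x) (hard_grad d r s y)
      = r * dist_Rd d (chain_grad d ?x) (chain_grad d ?y)"
    using dist_Rd_scale[of d r "chain_grad d ?x" "chain_grad d ?y"] assms
    by (simp add: hard_grad_def[abs_def])
  also have "\<dots> \<le> r * (45 * dist_Rd d ?x ?y)"
    using assms by (intro mult_left_mono chain_grad_lipschitz) auto
  also have "\<dots> = 45 * r / s * dist_Rd d x y"
    unfolding dist_Rd_scale using assms by simp
  finally show "dist_Rd d (hard_grad d r s x) (hard_grad d r s y) \<le> 45 * r / s * dist_Rd d x y" .
qed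

lemma hard_fun_lower_bound:
  assumes "0 < r" and "0 < s"
  shows "- (2 * real d * (r * s)) \<le> hard_fun d r s x"
  using mult_left_mono[OF chain_lower_bound[of d "\<lambda>j. (1 / s) * x j"], of "r * s"] assms
  by (simp add: hard_fun_def algebra_simps)

lemma hard_fun_zero_nonpos:
  assumes "0 < r" and "0 < s"
  shows "hard_fun d r s zero_vec \<le> 0"
  using chain_zero_nonpos[of d] assms by (simp add: hard_fun_def mult_nonneg_nonpos)

lemma hard_grad_large:
  assumes "0 < r" and "0 < d" and "x (d - 1) = 0"
  shows "r / 64 \<le> norm_Rd d (hard_grad d r s x)"
proof -
  obtain i where "i < d" and i: "1 / 64 \<le> \<bar>chain_grad d (\<lambda>j. (1 / s) * x j) i\<bar>"
    using chain_grad_large[of d "\<lambda>j. (1 / s) * x j"] assms by auto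
  have "r * (1 / 64) \<le> r * \<bar>chain_grad d (\<lambda>j. (1 / s) * x j) i\<bar>"
    using i assms by (intro mult_left_mono) auto
  also have "\<dots> = \<bar>hard_grad d r s x i\<bar>"
    using assms by (simp add: hard_grad_def abs_mult)
  also have "\<dots> \<le> norm_Rd d (hard_grad d r s x)"
    using \<open>i < d\<close> by (rule abs_coordinate_le_norm_Rd)
  finally show ?thesis by simp
qed

lemma hard_grad_zero_beyond: "supp x \<subseteq> {..<l} \<Longrightarrow> l < i \<Longrightarrow> hard_grad d r s x i = 0"
  unfolding hard_grad_def by (subst chain_grad_zero_beyond[of _ l]) (auto simp: supp_def)

lemma hard_grad_frontier_le:
  assumes "0 < r" and "supp x \<subseteq> {..<l}"
  shows "\<bar>hard_grad d r s x l\<bar> \<le> r"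
proof -
  have "\<bar>chain_grad d (\<lambda>j. (1 / s) * x j) l\<bar> \<le> 1"
    using assms(2) by (intro chain_grad_frontier_le_1) (auto simp: supp_def)
  then show ?thesis
    using assms(1) mult_left_mono[of _ 1 r] by (simp add: hard_grad_def abs_mult)
qed

section \<open>A stochastic oracle that hides the frontier\<close>

lemma measurable_coordinate_Rd [measurable]: "(\<lambda>x. x j) \<in> borel_Rd d \<rightarrow>\<^sub>M borel"
  by (rule measurable_restrict_space1) simp

lemma measurable_into_Rd:
  assumes "\<And>i. (\<lambda>w. h w i) \<in> borel_measurable M" and "\<And>w. w \<in> space M \<Longrightarrow> h w \<in> Rd d"
  shows "h \<in> M \<rightarrow>\<^sub>M borel_Rd d"
  using assms by (intro measurable_restrict_space2 measurable_coordinatewise_then_product) auto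

lemma measurable_tanh [measurable]: "(tanh :: real \<Rightarrow> real) \<in> borel_measurable borel"
  by (intro borel_measurable_continuous_onI continuous_on_tanh continuous_intros) auto

lemma measurable_hard_grad: "hard_grad d r s \<in> borel_Rd d \<rightarrow>\<^sub>M borel_Rd d"
proof (rule measurable_into_Rd)
  fix i
  show "(\<lambda>x. hard_grad d r s x i) \<in> borel_measurable (borel_Rd d)"
    unfolding hard_grad_def chain_grad_def gate_in_def gate_def gate'_def ramp_def ramp'_def
    by measurable
qed (rule hard_grad_in_Rd)

definition coin :: "real \<Rightarrow> real measure" where
  "coin q = distr (measure_pmf (bernoulli_pmf q)) borel (\<lambda>b. if b then 1 else 0)"

lemma sets_coin: "sets (coin q) = sets borel"
  by (simp add: coin_def)

lemma prob_space_coin: "prob_space (coin q)"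
  unfolding coin_def by (intro prob_space.prob_space_distr measure_pmf.prob_space_axioms) simp

lemma nn_integral_coin:
  assumes "0 \<le> q" "q \<le> 1" and "h \<in> borel_measurable borel"
  shows "(\<integral>\<^sup>+\<xi>. h \<xi> \<partial>coin q) = h 1 * ennreal q + h 0 * ennreal (1 - q)"
  unfolding coin_def using assms by (subst nn_integral_distr) simp_all

lemma integrable_coin:
  fixes h :: "real \<Rightarrow> real"
  assumes "h \<in> borel_measurable borel"
  shows "integrable (coin q) h"
  unfolding coin_def using assms
  by (subst integrable_distr_eq) (auto intro!: integrable_measure_pmf_finite)

lemma integral_coin:
  fixes h :: "real \<Rightarrow> real"
  assumes "0 \<le> q" "q \<le> 1" and "h \<in> borel_measurable borel"
  shows "(\<integral>\<xi>. h \<xi> \<partial>coin q) = h 1 * q + h 0 * (1 - q)"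
  unfolding coin_def using assms by (subst integral_distr) simp_all

text \<open>
  A coordinate \<open>i\<close> is at or beyond the frontier of \<open>x\<close> if \<open>x\<close> vanishes from \<open>i\<close> on. There the derivative
  is revealed only if the coin shows 1, and the factor \<open>1 / q\<close> makes up for the failures in
  expectation. By the zero-chain property at most one such coordinate has a derivative other than 0.
\<close>

definition frontier_oracle :: "real \<Rightarrow> (vector \<Rightarrow> vector) \<Rightarrow> vector \<Rightarrow> real \<Rightarrow> vector" where
  "frontier_oracle q gradf x \<xi> i =
     (if \<forall>j\<ge>i. x j = 0 then if \<xi> = 1 then 1 / q else 0 else 1) * gradf x i"

lemma all_zero_from_iff: "(\<forall>j\<ge>i. x j = 0) \<longleftrightarrow> supp x \<subseteq> {..<i}"
  by (simp add: supp_def subset_iff) (meson not_le)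

locale zero_chain =
  fixes gradf :: "vector \<Rightarrow> vector"
  assumes zero_beyond: "supp x \<subseteq> {..<l} \<Longrightarrow> l < i \<Longrightarrow> gradf x i = 0"
begin

lemma supp_frontier_oracle:
  assumes "supp x \<subseteq> {..<l}"
  shows "supp (frontier_oracle q gradf x \<xi>) \<subseteq> {..<Suc l}"
  using zero_beyond[OF assms] by (fastforce simp: supp_def frontier_oracle_def not_less_eq)

lemma supp_frontier_oracle_of_failure:
  assumes "supp x \<subseteq> {..<l}" and "\<xi> \<noteq> 1"
  shows "supp (frontier_oracle q gradf x \<xi>) \<subseteq> {..<l}"
proof
  fix i assume i: "i \<in> supp (frontier_oracle q gradf x \<xi>)"
  then have "\<not> supp x \<subseteq> {..<i}"
    using assms(2) by (auto simp: supp_def frontier_oracle_def all_zero_from_iff)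
  then show "i \<in> {..<l}"
    using assms(1) by fastforce
qed

text \<open>
  The error is concentrated in the single frontier coordinate \<open>l\<close>, where it is \<open>1 / q - 1\<close> or \<open>- 1\<close> times
  the true derivative. So the moment is that of a rescaled Bernoulli variable, and it is the smallness
  of the frontier derivative, not of the whole gradient, that matters.
\<close>

lemma stochastic_gradient_frontier_oracle:
  assumes q: "0 < q" "q \<le> 1" and "0 \<le> r" "0 < p"
    and meas: "gradf \<in> borel_Rd d \<rightarrow>\<^sub>M borel_Rd d"
    and frontier: "\<And>x l. supp x \<subseteq> {..<l} \<Longrightarrow> \<bar>gradf x l\<bar> \<le> r"
    and moment: "r powr p * (q * (1 / q - 1) powr p + (1 - q)) \<le> \<sigma> powr p"
  shows "stochastic_gradient d p \<sigma> gradf (coin q) (frontier_oracle q gradf)"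
  unfolding stochastic_gradient_def
proof (intro conjI ballI allI impI prob_space_coin sets_coin)
  let ?G = "frontier_oracle q gradf"
  have gradf_Rd: "gradf x \<in> Rd d" if "x \<in> Rd d" for x
    using measurable_space[OF meas, of x] that by (simp add: space_restrict_space)
  have [measurable]: "(\<lambda>x. gradf x i) \<in> borel_measurable (borel_Rd d)" for i
    using measurable_compose[OF meas measurable_coordinate_Rd] .
  have [measurable_cong]: "sets (coin q) = sets borel"
    by (rule sets_coin)
  show "case_prod ?G \<in> borel_Rd d \<Otimes>\<^sub>M coin q \<rightarrow>\<^sub>M borel_Rd d"
  proof (rule measurable_into_Rd)
    fix i
    show "(\<lambda>w. (case w of (x, \<xi>) \<Rightarrow> ?G x \<xi>) i) \<in> borel_measurable (borel_Rd d \<Otimes>\<^sub>M coin q)"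
      unfolding frontier_oracle_def case_prod_beta by measurable
  next
    fix w assume "w \<in> space (borel_Rd d \<Otimes>\<^sub>M coin q)"
    then show "(case w of (x, \<xi>) \<Rightarrow> ?G x \<xi>) \<in> Rd d"
      using gradf_Rd by (auto simp: space_pair_measure space_restrict_space frontier_oracle_def Rd_iff)
  qed
  fix x assume x: "x \<in> Rd d"
  define b :: "real \<Rightarrow> real" where "b \<xi> = (if \<xi> = 1 then 1 / q else 0)" for \<xi>
  have [measurable]: "b \<in> borel_measurable borel"
    unfolding b_def by measurable
  {
    fix j
    have [measurable]: "(\<lambda>\<xi>. ?G x \<xi> j) \<in> borel_measurable borel"
      unfolding frontier_oracle_def by measurable
    show "integrable (coin q) (\<lambda>\<xi>. ?G x \<xi> j)"
      by (rule integrable_coin) simp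
    show "(\<integral>\<xi>. ?G x \<xi> j \<partial>coin q) = gradf x j"
      using q by (subst integral_coin) (auto simp: frontier_oracle_def algebra_simps)
  }
  \<comment> \<open>the frontier of \<open>x\<close>\<close>
  define l where "l = (LEAST l. supp x \<subseteq> {..<l})"
  have "supp x \<subseteq> {..<d}"
    using x by (simp add: Rd_iff all_zero_from_iff)
  then have supp_l: "supp x \<subseteq> {..<l}"
    unfolding l_def by (rule LeastI)
  have err: "?G x \<xi> i - gradf x i = (if i = l then (b \<xi> - 1) * gradf x l else 0)" for \<xi> i
  proof (cases "i < l")
    case True
    then have "\<not> supp x \<subseteq> {..<i}"
      unfolding l_def by (rule not_less_Least)
    then show ?thesis
      using True by (simp add: frontier_oracle_def all_zero_from_iff)
  next
    case False
    then have "supp x \<subseteq> {..<i}"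
      using supp_l by auto
    then show ?thesis
      using False zero_beyond[OF supp_l, of i]
      by (auto simp: frontier_oracle_def all_zero_from_iff b_def algebra_simps)
  qed
  have dist_le: "dist_Rd d (?G x \<xi>) (gradf x) \<le> \<bar>b \<xi> - 1\<bar> * r" for \<xi>
  proof -
    have "dist_Rd d (?G x \<xi>) (gradf x) \<le> (\<Sum>i<d. if i = l then \<bar>b \<xi> - 1\<bar> * \<bar>gradf x l\<bar> else 0)"
      unfolding dist_Rd_def norm_Rd_def err
      by (rule order_trans[OF L2_set_le_sum_abs], rule sum_mono) (simp add: abs_mult)
    also have "\<dots> \<le> \<bar>b \<xi> - 1\<bar> * r"
      using frontier[OF supp_l] \<open>0 \<le> r\<close> by (auto intro!: mult_left_mono)
    finally show ?thesis .
  qed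
  have "(\<integral>\<^sup>+\<xi>. ennreal (dist_Rd d (?G x \<xi>) (gradf x) powr p) \<partial>coin q)
      \<le> (\<integral>\<^sup>+\<xi>. ennreal ((\<bar>b \<xi> - 1\<bar> * r) powr p) \<partial>coin q)"
    using dist_le \<open>0 < p\<close> dist_Rd_nonneg by (intro nn_integral_mono ennreal_leI powr_mono2) auto
  also have "\<dots> = ennreal ((\<bar>1 / q - 1\<bar> * r) powr p * q + r powr p * (1 - q))"
    using q by (subst nn_integral_coin) (auto simp: b_def ennreal_mult' ennreal_plus)
  also have "\<dots> \<le> ennreal (\<sigma> powr p)"
  proof (rule ennreal_leI)
    have "\<bar>1 / q - 1\<bar> = 1 / q - 1"
      using q by simp
    then show "(\<bar>1 / q - 1\<bar> * r) powr p * q + r powr p * (1 - q) \<le> \<sigma> powr p"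
      using moment powr_mult[of "1 / q - 1" r p] by (simp only: distrib_left mult_ac)
  qed
  finally show "(\<integral>\<^sup>+\<xi>. ennreal (dist_Rd d (?G x \<xi>) (gradf x) powr p) \<partial>coin q) \<le> ennreal (\<sigma> powr p)" .
qed

end

text \<open>
  For \<open>B > 1\<close> a success contributes at most \<open>q\<^bsup>1-p\<^esup> = B\<^bsup>p-1\<^esup>\<close> and a failure at most 1. For \<open>B \<le> 1\<close> the coin is
  deterministic and there is no error at all.
\<close>

lemma bernoulli_moment_le:
  fixes p q B :: real
  assumes "1 < p" and "0 < B" and q: "q = min 1 (1 / B)"
  shows "q * (1 / q - 1) powr p + (1 - q) \<le> 2 * B powr (p - 1)"
proof (cases "B \<le> 1")
  case True
  then have "q = 1"
    using q \<open>0 < B\<close> by simp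
  then show ?thesis by simp
next
  case False
  then have q_eq: "q = 1 / B"
    using q by simp
  have "q * (1 / q - 1) powr p \<le> q * B powr p"
    unfolding q_eq using False \<open>1 < p\<close> by (intro mult_left_mono powr_mono2) auto
  also have "\<dots> = B powr (p - 1)"
    using \<open>0 < B\<close> by (simp add: q_eq powr_diff)
  finally have "q * (1 / q - 1) powr p \<le> B powr (p - 1)" .
  moreover have "1 \<le> B powr (p - 1)"
    using False \<open>1 < p\<close> by (intro ge_one_powr_ge_zero) auto
  moreover have "0 < q"
    using q_eq False by simp
  ultimately show ?thesis
    by linarith
qed

lemma emeasure_coin_1:
  assumes "0 \<le> q" "q \<le> 1"
  shows "emeasure (coin q) {1} = ennreal q"
  using nn_integral_coin[OF assms, of "indicator {1}"] by (simp add: sets_coin)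


section \<open>Runs of an asynchronous algorithm\<close>

lemma ennreal_of_bool: "ennreal (of_bool b) = of_bool b"
  by (cases b) auto

lemma pred_conj_add_le:
  fixes s t :: "'a \<Rightarrow> real"
  assumes [measurable]: "Measurable.pred M b" "s \<in> borel_measurable M" "t \<in> borel_measurable M"
  shows "Measurable.pred M (\<lambda>\<omega>. b \<omega> \<and> s \<omega> + c \<le> t \<omega>)"
  by measurable

lemma decision_cong:
  assumes "\<And>j. j \<in> {1..k} \<Longrightarrow> g j = h j"
  shows "decision A k g = decision A k h"
  unfolding decision_def using assms by (intro arg_cong[where f = "A k"] restrict_ext)

locale async_run =
  fixes d n :: nat and \<tau> :: "nat \<Rightarrow> real" and A :: algorithm
    and G :: "vector \<Rightarrow> real \<Rightarrow> vector" and D :: "real measure"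
  assumes algorithm: "async_algorithm d n A"
    and prob_space_D: "prob_space D" and sets_D [measurable_cong]: "sets D = sets borel"
    and oracle_measurable: "case_prod G \<in> (borel_Rd d \<Otimes>\<^sub>M D) \<rightarrow>\<^sub>M borel_Rd d"
    and tau_pos: "\<And>i. i \<in> {1..n} \<Longrightarrow> 0 < \<tau> i"
begin

abbreviation "hist \<omega> k \<equiv> fst (run G \<tau> A \<omega> k)"
abbreviation "state \<omega> k \<equiv> snd (run G \<tau> A \<omega> k)"
abbreviation "start \<omega> k i \<equiv> fst (state \<omega> k i)"
abbreviation "requested \<omega> k i \<equiv> fst (snd (state \<omega> k i))"
abbreviation "busy \<omega> k i \<equiv> snd (snd (state \<omega> k i))"
abbreviation "worker \<omega> k \<equiv> next_worker A k (hist \<omega> k)"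
abbreviation "clock \<omega> k \<equiv> call_time G \<tau> A k \<omega>"
abbreviation "samples \<equiv> (\<Pi>\<^sub>M k\<in>(UNIV :: nat set). D)"

definition returns :: "(nat \<Rightarrow> real) \<Rightarrow> nat \<Rightarrow> bool" where
  "returns \<omega> k \<longleftrightarrow> busy \<omega> k (worker \<omega> k) \<and>
     start \<omega> k (worker \<omega> k) + \<tau> (worker \<omega> k) \<le> clock \<omega> (Suc k)"

lemma hist_Suc_agrees: "j \<le> k \<Longrightarrow> hist \<omega> (Suc k) j = hist \<omega> k j"
  by (simp add: Let_def case_prod_beta)

lemma clock_0: "clock \<omega> 0 = 0"
  by (simp add: call_time_def)

lemma clock_Suc: "clock \<omega> (Suc k) = fst (decision A k (hist \<omega> k))"
proof -
  have "decision A k (hist \<omega> (Suc k)) = decision A k (hist \<omega> k)"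
    by (intro decision_cong hist_Suc_agrees) simp
  then show ?thesis
    by (simp only: call_time_def wallclock.simps)
qed

lemma run_Suc_idle:
  assumes "\<not> busy \<omega> k (worker \<omega> k)"
  shows "run G \<tau> A \<omega> (Suc k) = ((hist \<omega> k)(Suc k := zero_vec),
    (state \<omega> k)(worker \<omega> k := (clock \<omega> (Suc k), iterate G \<tau> A k \<omega>, True)))"
  using assms
  by (cases "run G \<tau> A \<omega> k"; cases "state \<omega> k (worker \<omega> k)")
    (simp add: clock_Suc iterate_def)

lemma run_Suc_waiting:
  assumes "busy \<omega> k (worker \<omega> k)" and "\<not> returns \<omega> k"
  shows "run G \<tau> A \<omega> (Suc k) = ((hist \<omega> k)(Suc k := zero_vec), state \<omega> k)"
  using assms
  by (cases "run G \<tau> A \<omega> k"; cases "state \<omega> k (worker \<omega> k)")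
    (auto simp add: clock_Suc returns_def)

lemma run_Suc_returns:
  assumes "returns \<omega> k"
  shows "run G \<tau> A \<omega> (Suc k) =
    ((hist \<omega> k)(Suc k := G (requested \<omega> k (worker \<omega> k)) (\<omega> (Suc k))),
     (state \<omega> k)(worker \<omega> k := idle))"
  using assms
  by (cases "run G \<tau> A \<omega> k"; cases "state \<omega> k (worker \<omega> k)")
    (auto simp add: clock_Suc returns_def)

lemma step_cases:
  obtains (starts) "\<not> busy \<omega> k (worker \<omega> k)" "\<not> returns \<omega> k"
  | (waits) "busy \<omega> k (worker \<omega> k)" "\<not> returns \<omega> k"
  | (returns) "returns \<omega> k"
  by (auto simp: returns_def)

lemma run_cong:
  assumes "\<And>j. j \<in> {1..k} \<Longrightarrow> \<omega> j = \<omega>' j"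
  shows "run G \<tau> A \<omega> k = run G \<tau> A \<omega>' k"
  using assms
proof (induction k)
  case (Suc k)
  then have "run G \<tau> A \<omega> k = run G \<tau> A \<omega>' k" "\<omega> (Suc k) = \<omega>' (Suc k)"
    by auto
  then show ?case
    by simp
qed simp

abbreviation "state_space \<equiv> borel \<Otimes>\<^sub>M (borel_Rd d \<Otimes>\<^sub>M count_space UNIV)"
abbreviation "decision_space \<equiv> borel \<Otimes>\<^sub>M (count_space {1..n} \<Otimes>\<^sub>M borel_Rd d)"

lemma zero_vec_in_Rd: "zero_vec \<in> space (borel_Rd d)"
  by (simp add: space_restrict_space Rd_iff)

text \<open>
  The history and the worker states are random variables, by induction on the number of calls. The
  measurability of the decisions is needed inside that induction, hence the hypothesis.
\<close>

lemma decision_measurable_of_hist: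
  assumes [measurable]: "\<And>j. (\<lambda>\<omega>. hist \<omega> k j) \<in> samples \<rightarrow>\<^sub>M borel_Rd d"
  shows "(\<lambda>\<omega>. decision A k (hist \<omega> k)) \<in> samples \<rightarrow>\<^sub>M decision_space"
proof -
  have "A k \<in> (\<Pi>\<^sub>M j\<in>{1..k}. borel_Rd d) \<rightarrow>\<^sub>M decision_space"
    using algorithm by (simp add: async_algorithm_def)
  moreover have "(\<lambda>\<omega>. restrict (hist \<omega> k) {1..k}) \<in> samples \<rightarrow>\<^sub>M (\<Pi>\<^sub>M j\<in>{1..k}. borel_Rd d)"
    by (rule measurable_restrict) simp
  ultimately show ?thesis
    unfolding decision_def by (rule measurable_compose[rotated])
qed

lemma sfo_oracle_eq:
  "sfo_oracle G T t x s \<xi> =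
    (if \<not> snd (snd s) then ((t, x, True), zero_vec)
     else if t < fst s + T then ((fst s, fst (snd s), True), zero_vec)
     else (idle, G (fst (snd s)) \<xi>))"
  by (cases s) simp

lemma sfo_oracle_measurable:
  assumes [measurable]: "t \<in> borel_measurable M" "x \<in> M \<rightarrow>\<^sub>M borel_Rd d"
      "s \<in> M \<rightarrow>\<^sub>M state_space" "\<xi> \<in> M \<rightarrow>\<^sub>M D"
  shows "(\<lambda>w. sfo_oracle G T (t w) (x w) (s w) (\<xi> w)) \<in> M \<rightarrow>\<^sub>M state_space \<Otimes>\<^sub>M borel_Rd d"
proof -
  note zero_vec_in_Rd [measurable]
  have [measurable]: "(\<lambda>w. G (fst (snd (s w))) (\<xi> w)) \<in> M \<rightarrow>\<^sub>M borel_Rd d"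
    using measurable_compose[OF _ oracle_measurable, of "\<lambda>w. (fst (snd (s w)), \<xi> w)" M] by simp
  have [measurable]: "(\<lambda>w. zero_vec) \<in> M \<rightarrow>\<^sub>M borel_Rd d"
    using zero_vec_in_Rd by simp
  show ?thesis
    unfolding sfo_oracle_eq by measurable
qed

lemma run_measurable:
  "(\<forall>j. (\<lambda>\<omega>. hist \<omega> k j) \<in> samples \<rightarrow>\<^sub>M borel_Rd d) \<and>
   (\<forall>i. (\<lambda>\<omega>. state \<omega> k i) \<in> samples \<rightarrow>\<^sub>M state_space)"
proof (induction k)
  case 0
  show ?case
    using zero_vec_in_Rd by simp
next
  case (Suc k)
  then have hist [measurable]: "(\<lambda>\<omega>. hist \<omega> k j) \<in> samples \<rightarrow>\<^sub>M borel_Rd d"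
    and state [measurable]: "(\<lambda>\<omega>. state \<omega> k i) \<in> samples \<rightarrow>\<^sub>M state_space" for i j
    by auto
  note dec [measurable] = decision_measurable_of_hist[OF hist]
  have worker [measurable]: "(\<lambda>\<omega>. worker \<omega> k) \<in> samples \<rightarrow>\<^sub>M count_space {1..n}"
    unfolding next_worker_def by measurable
  define out where "out i \<omega> = sfo_oracle G (\<tau> i) (fst (decision A k (hist \<omega> k)))
    (point A k (hist \<omega> k)) (state \<omega> k i) (\<omega> (Suc k))" for i \<omega>
  have "(\<lambda>\<omega>. out i \<omega>) \<in> samples \<rightarrow>\<^sub>M state_space \<Otimes>\<^sub>M borel_Rd d" for i
    unfolding out_def point_def by (rule sfo_oracle_measurable) measurable
  then have out [measurable]: "(\<lambda>\<omega>. out (worker \<omega> k) \<omega>) \<in> samples \<rightarrow>\<^sub>M state_space \<Otimes>\<^sub>M borel_Rd d"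
    by (rule measurable_compose_countable'[OF _ worker]) auto
  have step: "run G \<tau> A \<omega> (Suc k) = ((hist \<omega> k)(Suc k := snd (out (worker \<omega> k) \<omega>)),
      (state \<omega> k)(worker \<omega> k := fst (out (worker \<omega> k) \<omega>)))" for \<omega>
    by (simp add: out_def Let_def case_prod_beta)
  have "(\<lambda>\<omega>. hist \<omega> (Suc k) j) \<in> samples \<rightarrow>\<^sub>M borel_Rd d" for j
    unfolding step by (cases "j = Suc k") simp_all
  moreover have "(\<lambda>\<omega>. state \<omega> (Suc k) i) \<in> samples \<rightarrow>\<^sub>M state_space" for i
  proof -
    have "(\<lambda>\<omega>. state \<omega> (Suc k) i)
        = (\<lambda>\<omega>. if worker \<omega> k = i then fst (out (worker \<omega> k) \<omega>) else state \<omega> k i)"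
      unfolding step by (auto simp: fun_eq_iff)
    moreover have "Measurable.pred samples (\<lambda>\<omega>. worker \<omega> k = i)"
      using measurable_compose[OF worker, of "\<lambda>j. j = i" "count_space UNIV"] by simp
    ultimately show ?thesis
      by simp
  qed
  ultimately show ?case
    by blast
qed

lemma hist_measurable [measurable]: "(\<lambda>\<omega>. hist \<omega> k j) \<in> samples \<rightarrow>\<^sub>M borel_Rd d"
  using run_measurable by blast

lemma state_measurable: "(\<lambda>\<omega>. state \<omega> k i) \<in> samples \<rightarrow>\<^sub>M state_space"
  using run_measurable by blast

lemma start_measurable: "(\<lambda>\<omega>. start \<omega> k i) \<in> borel_measurable samples"
  by (rule measurable_compose[OF state_measurable measurable_fst])

lemma busy_measurable: "Measurable.pred samples (\<lambda>\<omega>. busy \<omega> k i)"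
  by (rule measurable_compose[OF state_measurable
      measurable_compose[OF measurable_snd measurable_snd]])

lemma decision_measurable [measurable]:
  "(\<lambda>\<omega>. decision A k (hist \<omega> k)) \<in> samples \<rightarrow>\<^sub>M decision_space"
  by (rule decision_measurable_of_hist) simp

lemma worker_measurable [measurable]: "(\<lambda>\<omega>. worker \<omega> k) \<in> samples \<rightarrow>\<^sub>M count_space {1..n}"
  unfolding next_worker_def by measurable

lemma clock_measurable [measurable]: "(\<lambda>\<omega>. clock \<omega> k) \<in> borel_measurable samples"
  by (cases k) (simp_all add: clock_0 clock_Suc)

lemma pred_worker_measurable:
  assumes "\<And>i. i \<in> {1..n} \<Longrightarrow> Measurable.pred samples (P i)"
  shows "Measurable.pred samples (\<lambda>\<omega>. P (worker \<omega> k) \<omega>)"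
  using assms by (rule measurable_compose_countable'[OF _ worker_measurable]) auto

lemma returns_measurable [measurable]: "Measurable.pred samples (\<lambda>\<omega>. returns \<omega> k)"
proof -
  from pred_conj_add_le[OF busy_measurable start_measurable clock_measurable]
  show ?thesis
    unfolding returns_def
    by (intro pred_worker_measurable[where
        P = "\<lambda>i \<omega>. busy \<omega> k i \<and> start \<omega> k i + \<tau> i \<le> clock \<omega> (Suc k)"])
qed

lemma space_samples: "space samples = UNIV"
  using sets_eq_imp_space_eq[OF sets_D] by (simp add: space_PiM PiE_def)

lemma hist_in_Rd: "hist \<omega> k j \<in> Rd d"
  using measurable_space[OF hist_measurable, of \<omega> k j] by (simp add: space_samples space_restrict_space)

lemma worker_range: "worker \<omega> k \<in> {1..n}"
  using measurable_space[OF worker_measurable, of \<omega> k] by (simp add: space_samples)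

lemma restricted_hist:
  "restrict (hist \<omega> k) {1..k} \<in> space (\<Pi>\<^sub>M j\<in>{1..k}. borel_Rd d)"
  by (simp add: space_PiM space_restrict_space hist_in_Rd)

lemma clock_le_Suc: "clock \<omega> k \<le> clock \<omega> (Suc k)"
proof -
  have "wallclock A k (restrict (hist \<omega> k) {1..k}) = clock \<omega> k"
    unfolding call_time_def
    by (cases k) (auto intro!: arg_cong[where f = fst] decision_cong)
  moreover have "wallclock A (Suc k) (restrict (hist \<omega> k) {1..k}) = clock \<omega> (Suc k)"
    unfolding clock_Suc by (auto intro!: arg_cong[where f = fst] decision_cong)
  ultimately show ?thesis
    using algorithm restricted_hist by (metis async_algorithm_def)
qed

lemma supp_iterate: "supp (iterate G \<tau> A k \<omega>) \<subseteq> (\<Union>s\<in>{1..k}. supp (hist \<omega> k s))"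
proof -
  have "point A k (restrict (hist \<omega> k) {1..k}) = iterate G \<tau> A k \<omega>"
    unfolding iterate_def point_def
    by (auto intro!: arg_cong[where f = "\<lambda>t. snd (snd t)"] decision_cong)
  moreover have "supp (point A k (restrict (hist \<omega> k) {1..k}))
      \<subseteq> (\<Union>s\<in>{1..k}. supp (restrict (hist \<omega> k) {1..k} s))"
    using algorithm restricted_hist unfolding async_algorithm_def by blast
  ultimately show ?thesis
    by simp
qed

text \<open>
  The cutoff \<open>H\<close> restricts the count to calls up to wall-clock time \<open>H\<close>. An algorithm may make infinitely
  many calls up to that time, but only finitely many of them can return a gradient.
\<close>

definition return_count :: "real \<Rightarrow> (nat \<Rightarrow> real) \<Rightarrow> nat \<Rightarrow> nat \<Rightarrow> real" where
  "return_count H \<omega> i k =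
     (\<Sum>j<k. of_bool (returns \<omega> j \<and> worker \<omega> j = i \<and> clock \<omega> (Suc j) \<le> H))"

text \<open>
  Each gradient of worker \<open>i\<close> takes the worker at least \<open>\<tau> i\<close> units of time, and its computations do not
  overlap. For the induction the time spent is bounded by the start of the current computation
  whenever one is running.
\<close>

lemma return_count_bounds:
  assumes "0 \<le> H" and "i \<in> {1..n}"
  shows "return_count H \<omega> i k * \<tau> i \<le> H \<and> return_count H \<omega> i k * \<tau> i \<le> clock \<omega> k \<and>
    (busy \<omega> k i \<longrightarrow> return_count H \<omega> i k * \<tau> i \<le> start \<omega> k i)"
proof (induction k)
  case 0
  then show ?case
    using assms by (simp add: return_count_def clock_0)
next
  case (Suc k)
  note mono = clock_le_Suc[of k \<omega>]
  show ?case
  proof (cases rule: step_cases[of \<omega> k])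
    case starts
    have "return_count H \<omega> i (Suc k) = return_count H \<omega> i k"
      using starts by (simp add: return_count_def)
    then show ?thesis
      using Suc mono by (auto simp: run_Suc_idle[OF starts(1)] simp del: run.simps)
  next
    case waits
    have "return_count H \<omega> i (Suc k) = return_count H \<omega> i k"
      using waits by (simp add: return_count_def)
    then show ?thesis
      using Suc mono by (auto simp: run_Suc_waiting[OF waits] simp del: run.simps)
  next
    case returns
    show ?thesis
    proof (cases "worker \<omega> k = i")
      case True
      have "return_count H \<omega> i k * \<tau> i + \<tau> i \<le> clock \<omega> (Suc k)"
        using returns Suc True by (auto simp: returns_def)
      moreover have "return_count H \<omega> i (Suc k) * \<tau> i
          = return_count H \<omega> i k * \<tau> i + (if clock \<omega> (Suc k) \<le> H then \<tau> i else 0)"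
        using True returns by (simp add: return_count_def distrib_right)
      ultimately show ?thesis
        using True Suc mono by (auto simp: run_Suc_returns[OF returns] simp del: run.simps)
    next
      case False
      then have "return_count H \<omega> i (Suc k) = return_count H \<omega> i k"
        by (simp add: return_count_def)
      then show ?thesis
        using False Suc mono by (auto simp: run_Suc_returns[OF returns] simp del: run.simps)
    qed
  qed
qed

lemma start_nonneg:
  assumes "i \<in> {1..n}" and "busy \<omega> k i"
  shows "0 \<le> start \<omega> k i"
proof -
  have "0 \<le> return_count 0 \<omega> i k * \<tau> i"
    using tau_pos[OF assms(1)] by (simp add: return_count_def sum_nonneg)
  then show ?thesis
    using return_count_bounds[of 0 i \<omega> k] assms by simp
qed

text \<open>
  A worker is fast at scale \<open>t\<close> if it needs at most time \<open>t\<close> for a gradient. Only fast workers can make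
  progress in less time than \<open>t\<close>, and only their gradients are counted.
\<close>

definition fast_return :: "real \<Rightarrow> real \<Rightarrow> (nat \<Rightarrow> real) \<Rightarrow> nat \<Rightarrow> bool" where
  "fast_return t H \<omega> k \<longleftrightarrow> returns \<omega> k \<and> \<tau> (worker \<omega> k) \<le> t \<and> clock \<omega> (Suc k) \<le> H"

lemma fast_return_measurable [measurable]:
  "Measurable.pred samples (\<lambda>\<omega>. fast_return t H \<omega> k)"
proof -
  have [measurable]: "Measurable.pred samples (\<lambda>\<omega>. \<tau> (worker \<omega> k) \<le> t)"
    by (rule pred_worker_measurable[where P = "\<lambda>i \<omega>. \<tau> i \<le> t"]) simp
  show ?thesis
    unfolding fast_return_def by measurable
qed

lemma fast_return_count_le:
  assumes "0 \<le> H"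
  shows "(\<Sum>j<k. of_bool (fast_return t H \<omega> j)) \<le> H * (\<Sum>i\<in>{i\<in>{1..n}. \<tau> i \<le> t}. 1 / \<tau> i)"
proof -
  let ?F = "{i\<in>{1..n}. \<tau> i \<le> t}"
  have "of_bool (fast_return t H \<omega> j)
      = (\<Sum>i\<in>?F. of_bool (returns \<omega> j \<and> worker \<omega> j = i \<and> clock \<omega> (Suc j) \<le> H) :: real)" for j
  proof -
    have "(\<Sum>i\<in>?F. of_bool (returns \<omega> j \<and> worker \<omega> j = i \<and> clock \<omega> (Suc j) \<le> H) :: real)
        = (\<Sum>i\<in>?F. if worker \<omega> j = i then of_bool (returns \<omega> j \<and> clock \<omega> (Suc j) \<le> H) else 0)"
      by (intro sum.cong) auto
    also have "\<dots> = of_bool (fast_return t H \<omega> j)"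
      using worker_range[of j \<omega>] by (subst sum.delta') (auto simp: fast_return_def)
    finally show ?thesis ..
  qed
  then have "(\<Sum>j<k. of_bool (fast_return t H \<omega> j)) = (\<Sum>i\<in>?F. return_count H \<omega> i k)"
    unfolding return_count_def by (simp only: sum.swap[of _ ?F])
  also have "\<dots> \<le> (\<Sum>i\<in>?F. H * (1 / \<tau> i))"
    using return_count_bounds[OF assms] tau_pos by (intro sum_mono) (auto simp: field_simps)
  finally show ?thesis
    by (simp add: sum_distrib_left)
qed

definition fast_successes :: "real \<Rightarrow> real \<Rightarrow> (nat \<Rightarrow> real) \<Rightarrow> nat \<Rightarrow> real" where
  "fast_successes t H \<omega> k = (\<Sum>j<k. of_bool (fast_return t H \<omega> j \<and> \<omega> (Suc j) = 1))"

lemma fast_successes_nonneg: "0 \<le> fast_successes t H \<omega> k"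
  by (simp add: fast_successes_def sum_nonneg)

lemma lessThan_nat_floor_mono: "a \<le> b \<Longrightarrow> {..<nat \<lfloor>a\<rfloor>} \<subseteq> {..<nat \<lfloor>b\<rfloor>}" for a b :: real
  by (auto intro: order_less_le_trans nat_mono floor_mono)

text \<open>
  The level of a vector is the number of leading coordinates that contain its support. If there were
  \<open>S\<close> fast successes so far, then \<open>level - S\<close> times \<open>t\<close> is at most the current wall-clock time for
  every returned vector, and at most the start of the computation for every requested point. This is
  preserved by every call: a failure keeps the level; a success of a slow worker raises the level by
  one but arrives more than \<open>t\<close> after the start of its computation; a success of a fast worker raises
  both the level and \<open>S\<close> by one. Measuring from the start of the computation is what makes outdated
  computations harmless, as they can only extend the support of the point at which they were started.
\<close>

lemma progress_bound:
  assumes "0 < t"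
    and one_step: "\<And>x l \<xi>. supp x \<subseteq> {..<l} \<Longrightarrow> supp (G x \<xi>) \<subseteq> {..<Suc l}"
    and failure: "\<And>x l \<xi>. supp x \<subseteq> {..<l} \<Longrightarrow> \<xi> \<noteq> 1 \<Longrightarrow> supp (G x \<xi>) \<subseteq> {..<l}"
    and "clock \<omega> k \<le> H"
  shows "(\<forall>j\<in>{1..k}. supp (hist \<omega> k j) \<subseteq> {..<nat \<lfloor>clock \<omega> k / t + fast_successes t H \<omega> k\<rfloor>}) \<and>
    (\<forall>i. busy \<omega> k i \<longrightarrow>
      supp (requested \<omega> k i) \<subseteq> {..<nat \<lfloor>start \<omega> k i / t + fast_successes t H \<omega> k\<rfloor>})"
  using assms(4)
proof (induction k)
  case 0
  then show ?case by simp
next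
  case (Suc k)
  let ?S = "fast_successes t H \<omega>"
  define level where "level k a = {..<nat \<lfloor>a / t + ?S k\<rfloor>}" for k a
  have S_mono: "?S k \<le> ?S (Suc k)"
    by (simp add: fast_successes_def)
  have level_mono: "level k a \<subseteq> level (Suc k) b" if "a \<le> b" for a b
    unfolding level_def using that \<open>0 < t\<close> S_mono
    by (intro lessThan_nat_floor_mono add_mono divide_right_mono) auto
  note clock_mono = clock_le_Suc[of k \<omega>]
  have IH: "\<And>j. j \<in> {1..k} \<Longrightarrow> supp (hist \<omega> k j) \<subseteq> level k (clock \<omega> k)"
    "\<And>i. busy \<omega> k i \<Longrightarrow> supp (requested \<omega> k i) \<subseteq> level k (start \<omega> k i)"
    using Suc clock_mono by (auto simp: level_def)
  have old_hist: "supp (hist \<omega> k j) \<subseteq> level (Suc k) (clock \<omega> (Suc k))" if "j \<in> {1..k}" for j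
    using IH(1)[OF that] level_mono[OF clock_mono] by blast
  have old_busy: "supp (requested \<omega> k i) \<subseteq> level (Suc k) (start \<omega> k i)" if "busy \<omega> k i" for i
    using IH(2)[OF that] level_mono[OF order_refl] by blast
  have zero: "supp zero_vec = {}"
    by (simp add: supp_def)
  have all_hist: "\<forall>j\<in>{1..Suc k}. supp (hist \<omega> (Suc k) j) \<subseteq> level (Suc k) (clock \<omega> (Suc k))"
    if new: "supp (hist \<omega> (Suc k) (Suc k)) \<subseteq> level (Suc k) (clock \<omega> (Suc k))"
  proof
    fix j assume "j \<in> {1..Suc k}"
    then consider "j = Suc k" | "j \<in> {1..k}" by force
    then show "supp (hist \<omega> (Suc k) j) \<subseteq> level (Suc k) (clock \<omega> (Suc k))"
    proof cases
      case 2
      then show ?thesis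
        using old_hist hist_Suc_agrees[of j k \<omega>] by simp
    qed (use new in simp)
  qed
  have "(\<forall>j\<in>{1..Suc k}. supp (hist \<omega> (Suc k) j) \<subseteq> level (Suc k) (clock \<omega> (Suc k))) \<and>
    (\<forall>i. busy \<omega> (Suc k) i \<longrightarrow> supp (requested \<omega> (Suc k) i) \<subseteq> level (Suc k) (start \<omega> (Suc k) i))"
  proof (cases rule: step_cases[of \<omega> k])
    case starts
    have "supp (iterate G \<tau> A k \<omega>) \<subseteq> level (Suc k) (clock \<omega> (Suc k))"
      using supp_iterate[of k \<omega>] old_hist by blast
    then show ?thesis
      using old_busy
      by (intro conjI all_hist) (simp_all add: run_Suc_idle[OF starts(1)] zero del: run.simps)
  next
    case waits
    then show ?thesis
      using old_busy
      by (intro conjI all_hist) (simp_all add: run_Suc_waiting[OF waits] zero del: run.simps)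
  next
    case returns
    let ?i = "worker \<omega> k"
    let ?b = "start \<omega> k ?i"
    let ?x = "requested \<omega> k ?i" and ?\<xi> = "\<omega> (Suc k)"
    have busy: "busy \<omega> k ?i" and due: "?b + \<tau> ?i \<le> clock \<omega> (Suc k)"
      using returns by (auto simp: returns_def)
    have "0 \<le> ?b"
      using start_nonneg[OF worker_range busy] .
    have "0 < \<tau> ?i"
      using tau_pos[OF worker_range] .
    have x: "supp ?x \<subseteq> {..<nat \<lfloor>?b / t + ?S k\<rfloor>}"
      using IH(2)[OF busy] by (simp add: level_def)
    have "supp (G ?x ?\<xi>) \<subseteq> level (Suc k) (clock \<omega> (Suc k))"
    proof (cases "?\<xi> = 1")
      case False
      have "?b \<le> clock \<omega> (Suc k)"
        using due \<open>0 < \<tau> ?i\<close> by simp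
      then have "{..<nat \<lfloor>?b / t + ?S k\<rfloor>} \<subseteq> level (Suc k) (clock \<omega> (Suc k))"
        using level_mono[of ?b] by (simp only: level_def)
      then show ?thesis
        by (rule subset_trans[OF failure[OF x False]])
    next
      case True
      have le: "?b / t + ?S k + 1 \<le> clock \<omega> (Suc k) / t + ?S (Suc k)"
      proof (cases "\<tau> ?i \<le> t")
        case fast: True
        then have "?S (Suc k) = ?S k + 1"
          using True returns Suc.prems by (simp add: fast_successes_def fast_return_def)
        moreover have "?b / t \<le> clock \<omega> (Suc k) / t"
          using due \<open>0 < \<tau> ?i\<close> \<open>0 < t\<close> by (intro divide_right_mono) auto
        ultimately show ?thesis by simp
      next
        case False
        have "(?b + t) / t \<le> clock \<omega> (Suc k) / t"
          using due False \<open>0 < t\<close> by (intro divide_right_mono) auto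
        then show ?thesis
          using S_mono \<open>0 < t\<close> by (simp add: add_divide_distrib)
      qed
      have Suc_floor: "Suc (nat \<lfloor>?b / t + ?S k\<rfloor>) = nat \<lfloor>?b / t + ?S k + 1\<rfloor>"
      proof -
        have "0 \<le> ?b / t + ?S k"
          using \<open>0 \<le> ?b\<close> \<open>0 < t\<close> fast_successes_nonneg by simp
        then show ?thesis
          by (simp add: Suc_nat_eq_nat_zadd1 add.commute)
      qed
      show ?thesis
        using subset_trans[OF one_step[OF x, of ?\<xi>, unfolded Suc_floor] lessThan_nat_floor_mono[OF le]]
        by (simp only: level_def)
    qed
    then show ?thesis
      using old_busy
      by (intro conjI all_hist) (simp_all add: run_Suc_returns[OF returns] del: run.simps)
  qed
  then show ?case
    by (simp add: level_def)
qed

lemma prob_space_samples: "prob_space samples"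
  using prob_space_D by (intro prob_space_PiM)

text \<open>
  Whether call \<open>k + 1\<close> is a fast return is determined by the samples \<open>1, \<dots>, k\<close>, so it is independent of
  sample \<open>k + 1\<close>. The independence is used in the form that redrawing this one sample leaves the joint
  distribution unchanged.
\<close>

lemma nn_integral_fast_success:
  "(\<integral>\<^sup>+\<omega>. of_bool (fast_return t H \<omega> k \<and> \<omega> (Suc k) = 1) \<partial>samples)
    = emeasure D {1} * (\<integral>\<^sup>+\<omega>. of_bool (fast_return t H \<omega> k) \<partial>samples)"
proof -
  interpret samples: prob_space samples
    by (rule prob_space_samples)
  define upd where "upd = (\<lambda>(\<xi>, \<omega>). (\<omega> :: nat \<Rightarrow> real)(Suc k := \<xi>))"
  have upd [measurable]: "upd \<in> D \<Otimes>\<^sub>M samples \<rightarrow>\<^sub>M samples"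
    unfolding upd_def case_prod_beta by (rule measurable_fun_upd[where J = UNIV]) auto
  have resample: "distr (D \<Otimes>\<^sub>M samples) samples upd = samples"
    using distr_pair_PiM_eq_PiM[of UNIV "\<lambda>_. D" "Suc k"] prob_space_D
    by (simp add: upd_def)
  have indep: "fast_return t H (fun_upd \<omega> (Suc k) \<xi>) k \<longleftrightarrow> fast_return t H \<omega> k" for \<omega> \<xi>
  proof -
    have "run G \<tau> A (fun_upd \<omega> (Suc k) \<xi>) k = run G \<tau> A \<omega> k"
      by (rule run_cong) simp
    then show ?thesis
      by (simp only: fast_return_def returns_def clock_Suc)
  qed
  have [measurable]: "(\<lambda>\<omega>. of_bool (fast_return t H \<omega> k \<and> \<omega> (Suc k) = 1) :: ennreal)
      \<in> borel_measurable samples"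
    by measurable
  have "(\<integral>\<^sup>+\<omega>. of_bool (fast_return t H \<omega> k \<and> \<omega> (Suc k) = 1) \<partial>samples)
      = (\<integral>\<^sup>+w. of_bool (fast_return t H (upd w) k \<and> upd w (Suc k) = 1) \<partial>(D \<Otimes>\<^sub>M samples))"
    by (subst (1) resample[symmetric], rule nn_integral_distr) simp_all
  also have "\<dots> = (\<integral>\<^sup>+\<xi>. (\<integral>\<^sup>+\<omega>. of_bool (fast_return t H (upd (\<xi>, \<omega>)) k \<and> upd (\<xi>, \<omega>) (Suc k) = 1)
      \<partial>samples) \<partial>D)"
    by (rule samples.nn_integral_fst[symmetric]) simp
  also have "\<dots> = (\<integral>\<^sup>+\<xi>. indicator {1} \<xi> * (\<integral>\<^sup>+\<omega>. of_bool (fast_return t H \<omega> k) \<partial>samples) \<partial>D)"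
    by (intro nn_integral_cong) (simp add: upd_def indep split: split_indicator)
  also have "\<dots> = emeasure D {1} * (\<integral>\<^sup>+\<omega>. of_bool (fast_return t H \<omega> k) \<partial>samples)"
  proof -
    have "{1} \<in> sets D"
      by (simp add: sets_D)
    then show ?thesis
      by (subst nn_integral_multc[OF borel_measurable_indicator]) simp_all
  qed
  finally show ?thesis .
qed

text \<open>
  The number of fast returns up to time \<open>H\<close> has a deterministic bound, and each of them is a success
  with the probability of the outcome 1 only.
\<close>

lemma expected_fast_successes_le:
  assumes "0 \<le> H"
  shows "(\<integral>\<^sup>+\<omega>. (\<Sum>k. of_bool (fast_return t H \<omega> k \<and> \<omega> (Suc k) = 1)) \<partial>samples)
    \<le> emeasure D {1} * ennreal (H * (\<Sum>i\<in>{i\<in>{1..n}. \<tau> i \<le> t}. 1 / \<tau> i))"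
proof -
  interpret samples: prob_space samples
    by (rule prob_space_samples)
  let ?C = "H * (\<Sum>i\<in>{i\<in>{1..n}. \<tau> i \<le> t}. 1 / \<tau> i)"
  have "(\<Sum>j<k. of_bool (fast_return t H \<omega> j) :: ennreal)
      = ennreal (\<Sum>j<k. of_bool (fast_return t H \<omega> j))"
    for k \<omega>
    by (simp add: sum_ennreal[symmetric] ennreal_of_bool del: sum_of_bool_eq)
  then have total: "(\<Sum>k. of_bool (fast_return t H \<omega> k) :: ennreal) \<le> ennreal ?C" for \<omega>
    unfolding suminf_eq_SUP by (simp only:) (intro SUP_least ennreal_leI fast_return_count_le[OF assms])
  have "(\<integral>\<^sup>+\<omega>. (\<Sum>k. of_bool (fast_return t H \<omega> k \<and> \<omega> (Suc k) = 1)) \<partial>samples)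
      = (\<Sum>k. emeasure D {1} * (\<integral>\<^sup>+\<omega>. of_bool (fast_return t H \<omega> k) \<partial>samples))"
    by (subst nn_integral_suminf) (simp_all add: nn_integral_fast_success)
  also have "\<dots> = emeasure D {1} * (\<integral>\<^sup>+\<omega>. (\<Sum>k. of_bool (fast_return t H \<omega> k)) \<partial>samples)"
    by (subst nn_integral_suminf) simp_all
  also have "\<dots> \<le> emeasure D {1} * (\<integral>\<^sup>+\<omega>. ennreal ?C \<partial>samples)"
    by (intro mult_left_mono nn_integral_mono total) simp
  finally show ?thesis
    by (simp add: samples.emeasure_space_1)
qed

text \<open>
  Up to time \<open>d * t / 2\<close> a point with a nonzero last coordinate requires at least \<open>d / 2\<close> fast
  successes, by \<open>progress_bound\<close>. So on every sample the gradient at an available point has norm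
  at least \<open>2 * \<epsilon>\<close>, unless the number \<open>S\<close> of fast successes is at least \<open>d / 2\<close>, in which case
  \<open>4 * \<epsilon> / d * S\<close> is at least \<open>2 * \<epsilon>\<close>. The sum of the two quantities is thus at least \<open>2 * \<epsilon>\<close>, for
  whichever available point is chosen in hindsight. Since the expectation of \<open>S\<close> is at most \<open>d / 6\<close>, the
  expected norm is at least \<open>4 / 3 * \<epsilon>\<close>.
\<close>

lemma not_stationary_found_by:
  fixes gradf :: "vector \<Rightarrow> vector"
  assumes "0 < t" and "0 < d" and "0 < \<epsilon>" and "0 \<le> q"
    and one_step: "\<And>x l \<xi>. supp x \<subseteq> {..<l} \<Longrightarrow> supp (G x \<xi>) \<subseteq> {..<Suc l}"
    and failure: "\<And>x l \<xi>. supp x \<subseteq> {..<l} \<Longrightarrow> \<xi> \<noteq> 1 \<Longrightarrow> supp (G x \<xi>) \<subseteq> {..<l}"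
    and success_prob: "emeasure D {1} = ennreal q"
    and gradf_measurable: "gradf \<in> borel_Rd d \<rightarrow>\<^sub>M borel_Rd d"
    and large: "\<And>x. x (d - 1) = 0 \<Longrightarrow> 2 * \<epsilon> \<le> norm_Rd d (gradf x)"
    and few: "q * (t * (\<Sum>i\<in>{i\<in>{1..n}. \<tau> i \<le> t}. 1 / \<tau> i)) \<le> 1 / 3"
    and T: "T \<le> real d * t / 2"
  shows "\<not> stationary_found_by d gradf D G \<tau> A \<epsilon> T"
proof
  interpret samples: prob_space samples
    by (rule prob_space_samples)
  define H where "H = real d * t / 2"
  have "0 \<le> H"
    using \<open>0 < t\<close> by (simp add: H_def)
  define S :: "(nat \<Rightarrow> real) \<Rightarrow> ennreal"
    where "S \<omega> = (\<Sum>k. of_bool (fast_return t H \<omega> k \<and> \<omega> (Suc k) = 1))" for \<omega>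
  have [measurable]: "S \<in> borel_measurable samples"
    unfolding S_def by measurable
  have S_ge: "ennreal (fast_successes t H \<omega> k) \<le> S \<omega>" for \<omega> k
  proof -
    have "ennreal (fast_successes t H \<omega> k)
        = (\<Sum>j<k. of_bool (fast_return t H \<omega> j \<and> \<omega> (Suc j) = 1))"
      unfolding fast_successes_def
      by (simp add: sum_ennreal[symmetric] ennreal_of_bool del: sum_of_bool_eq)
    then show ?thesis
      unfolding S_def by (simp add: sum_le_suminf del: sum_of_bool_eq)
  qed
  assume "stationary_found_by d gradf D G \<tau> A \<epsilon> T"
  then obtain xhat where [measurable]: "xhat \<in> samples \<rightarrow>\<^sub>M borel_Rd d"
    and found: "AE \<omega> in samples. xhat \<omega> \<in> {iterate G \<tau> A k \<omega> | k. clock \<omega> k \<le> T}"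
    and small: "(\<integral>\<^sup>+\<omega>. ennreal (norm_Rd d (gradf (xhat \<omega>))) \<partial>samples) \<le> ennreal \<epsilon>"
    unfolding stationary_found_by_def Let_def by blast
  have [measurable]: "(\<lambda>\<omega>. gradf (xhat \<omega>) j) \<in> borel_measurable samples" for j
    by (rule measurable_compose[OF _ measurable_coordinate_Rd])
      (rule measurable_compose[OF _ gradf_measurable], simp)
  have [measurable]: "(\<lambda>\<omega>. norm_Rd d (gradf (xhat \<omega>))) \<in> borel_measurable samples"
    unfolding norm_Rd_def L2_set_def by measurable
  have "ennreal (2 * \<epsilon>) \<le> ennreal (norm_Rd d (gradf x)) + ennreal (4 * \<epsilon> / real d) * S \<omega>"
    if x: "x = iterate G \<tau> A k \<omega>" and k: "clock \<omega> k \<le> T" for x \<omega> k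
  proof (cases "x (d - 1) = 0")
    case True
    then show ?thesis
      using large[of x] True by (intro add_increasing2 ennreal_leI) auto
  next
    case False
    have "clock \<omega> k \<le> H"
      using k T by (simp add: H_def)
    then have "supp (hist \<omega> k j) \<subseteq> {..<nat \<lfloor>clock \<omega> k / t + fast_successes t H \<omega> k\<rfloor>}"
      if "j \<in> {1..k}" for j
      using progress_bound[OF \<open>0 < t\<close> one_step failure] that by blast
    then have "supp x \<subseteq> {..<nat \<lfloor>clock \<omega> k / t + fast_successes t H \<omega> k\<rfloor>}"
      using supp_iterate[of k \<omega>] x by blast
    then have "d - 1 < nat \<lfloor>clock \<omega> k / t + fast_successes t H \<omega> k\<rfloor>"
      using False by (auto simp: supp_def)
    then have "real d \<le> clock \<omega> k / t + fast_successes t H \<omega> k"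
      using \<open>0 < d\<close> by linarith
    moreover have "clock \<omega> k / t \<le> real d / 2"
      using \<open>clock \<omega> k \<le> H\<close> \<open>0 < t\<close> by (simp add: H_def field_simps)
    ultimately have "real d / 2 \<le> fast_successes t H \<omega> k"
      by linarith
    then have "4 * \<epsilon> / real d * (real d / 2) \<le> 4 * \<epsilon> / real d * fast_successes t H \<omega> k"
      using \<open>0 < \<epsilon>\<close> by (intro mult_left_mono) auto
    then have "ennreal (2 * \<epsilon>) \<le> ennreal (4 * \<epsilon> / real d * fast_successes t H \<omega> k)"
      using \<open>0 < d\<close> by (intro ennreal_leI) simp
    also have "\<dots> = ennreal (4 * \<epsilon> / real d) * ennreal (fast_successes t H \<omega> k)"
      using \<open>0 < \<epsilon>\<close> by (intro ennreal_mult fast_successes_nonneg) simp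
    also have "\<dots> \<le> ennreal (4 * \<epsilon> / real d) * S \<omega>"
      by (intro mult_left_mono S_ge) simp
    finally show ?thesis
      by (intro add_increasing) auto
  qed
  then have "AE \<omega> in samples. ennreal (2 * \<epsilon>)
      \<le> ennreal (norm_Rd d (gradf (xhat \<omega>))) + ennreal (4 * \<epsilon> / real d) * S \<omega>"
    using found by (auto elim!: eventually_mono)
  then have "(\<integral>\<^sup>+\<omega>. ennreal (2 * \<epsilon>) \<partial>samples)
      \<le> (\<integral>\<^sup>+\<omega>. ennreal (norm_Rd d (gradf (xhat \<omega>))) + ennreal (4 * \<epsilon> / real d) * S \<omega> \<partial>samples)"
    by (rule nn_integral_mono_AE)
  also have "\<dots> = (\<integral>\<^sup>+\<omega>. ennreal (norm_Rd d (gradf (xhat \<omega>))) \<partial>samples)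
      + ennreal (4 * \<epsilon> / real d) * (\<integral>\<^sup>+\<omega>. S \<omega> \<partial>samples)"
    by (simp add: nn_integral_add nn_integral_cmult)
  also have "\<dots> \<le> ennreal \<epsilon> + ennreal (4 * \<epsilon> / real d) * ennreal (real d / 6)"
  proof (intro add_mono small mult_left_mono)
    have "(\<integral>\<^sup>+\<omega>. S \<omega> \<partial>samples)
        \<le> ennreal q * ennreal (H * (\<Sum>i\<in>{i\<in>{1..n}. \<tau> i \<le> t}. 1 / \<tau> i))"
      using expected_fast_successes_le[OF \<open>0 \<le> H\<close>] by (simp add: S_def success_prob)
    also have "\<dots> = ennreal (q * (H * (\<Sum>i\<in>{i\<in>{1..n}. \<tau> i \<le> t}. 1 / \<tau> i)))"
      using \<open>0 \<le> H\<close> \<open>0 \<le> q\<close> tau_pos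
      by (intro ennreal_mult[symmetric] mult_nonneg_nonneg sum_nonneg) (auto simp: less_imp_le)
    also have "\<dots> \<le> ennreal (real d / 6)"
      using mult_left_mono[OF few, of "real d / 2"]
      by (intro ennreal_leI) (simp add: H_def algebra_simps)
    finally show "(\<integral>\<^sup>+\<omega>. S \<omega> \<partial>samples) \<le> ennreal (real d / 6)" .
  qed simp
  also have "\<dots> = ennreal (\<epsilon> + 4 * \<epsilon> / real d * (real d / 6))"
    using \<open>0 < \<epsilon>\<close> by (subst ennreal_mult[symmetric], simp, simp, subst ennreal_plus) simp_all
  also have "4 * \<epsilon> / real d * (real d / 6) = 2 * \<epsilon> / 3"
    using \<open>0 < d\<close> by simp
  finally have "ennreal (2 * \<epsilon>) \<le> ennreal (\<epsilon> + 2 * \<epsilon> / 3)"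
    by (simp only: nn_integral_const samples.emeasure_space_1 mult_1_right)
  then show False
    using \<open>0 < \<epsilon>\<close> by (simp add: ennreal_le_iff)
qed

end

section \<open>The time scale of a single success\<close>

lemma filter_le_eq_take:
  "sorted ys \<Longrightarrow> filter (\<lambda>x. x \<le> t) ys = take (length (filter (\<lambda>x. x \<le> t) ys)) ys"
  for t :: "'a :: linorder"
proof (induction ys)
  case (Cons y ys)
  show ?case
  proof (cases "y \<le> t")
    case False
    then have "filter (\<lambda>x. x \<le> t) ys = []"
      using Cons.prems by (auto simp: filter_empty_conv)
    then show ?thesis
      using False by simp
  qed (use Cons in auto)
qed simp

text \<open>
  The fast workers are an initial segment of the workers sorted by speed.
\<close>

lemma sum_fast_eq_sum_ordered_time:
  "(\<Sum>i\<in>{i\<in>{1..n}. \<tau> i \<le> t}. 1 / \<tau> i)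
    = (\<Sum>i=1..card {i\<in>{1..n}. \<tau> i \<le> t}. 1 / ordered_time n \<tau> i)"
proof -
  let ?F = "{i\<in>{1..n}. \<tau> i \<le> t}" and ?P = "\<lambda>x. x \<le> t"
  let ?xs = "map \<tau> [1..<Suc n]"
  let ?ys = "sort ?xs"
  have F: "set (filter (\<lambda>i. \<tau> i \<le> t) [1..<Suc n]) = ?F"
    by auto
  have filter_xs: "filter ?P ?xs = map \<tau> (filter (\<lambda>i. \<tau> i \<le> t) [1..<Suc n])"
    by (simp only: filter_map o_def)
  have mset: "mset (filter ?P ?ys) = mset (filter ?P ?xs)"
    by (simp only: mset_filter mset_sort)
  have "card ?F = length (filter (\<lambda>i. \<tau> i \<le> t) [1..<Suc n])"
    by (subst F[symmetric], rule distinct_card) (simp only: distinct_filter distinct_upt)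
  also have "\<dots> = length (filter ?P ?ys)"
    using mset_eq_length[OF mset] by (simp only: filter_xs length_map)
  finally have len: "card ?F = length (filter ?P ?ys)" .
  then have take: "filter ?P ?ys = take (card ?F) ?ys"
    using filter_le_eq_take[OF sorted_sort, of t ?xs] by (simp only:)
  have card_le: "card ?F \<le> length ?ys"
    unfolding len by (rule length_filter_le)
  have "(\<Sum>i\<in>?F. 1 / \<tau> i) = sum_list (map (\<lambda>i. 1 / \<tau> i) (filter (\<lambda>i. \<tau> i \<le> t) [1..<Suc n]))"
    unfolding F[symmetric]
    by (rule sum_list_distinct_conv_sum_set[symmetric]) (simp only: distinct_filter distinct_upt)
  also have "\<dots> = sum_list (map (\<lambda>x. 1 / x) (filter ?P ?xs))"
    by (simp only: filter_xs map_map o_def)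
  also have "\<dots> = sum_list (map (\<lambda>x. 1 / x) (filter ?P ?ys))"
    unfolding sum_mset_sum_list[symmetric] mset_map mset ..
  also have "\<dots> = (\<Sum>i<card ?F. 1 / ?ys ! i)"
    unfolding take using card_le
    by (simp only: sum_list_sum_nth length_map length_take min_absorb2 atLeast0LessThan)
      (rule sum.cong, auto)
  also have "\<dots> = (\<Sum>i=1..card ?F. 1 / ordered_time n \<tau> i)"
    unfolding ordered_time_def by (simp only: One_nat_def sum.atLeast1_atMost_eq diff_Suc_Suc diff_zero)
  finally show ?thesis .
qed

lemma ordered_time_pos:
  assumes "\<forall>i\<in>{1..n}. 0 < \<tau> i" and "i \<in> {1..n}"
  shows "0 < ordered_time n \<tau> i"
proof -
  have "ordered_time n \<tau> i \<in> set (sort (map \<tau> [1..<Suc n]))"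
    unfolding ordered_time_def using assms(2) by (intro nth_mem) auto
  then show ?thesis
    using assms(1) by auto
qed

text \<open>
  At most \<open>B / 3\<close> gradients are produced by the fast workers within time \<open>t\<close>. If \<open>m\<close> workers are fast and
  \<open>Y\<close> is their total number \<open>t / \<tau>\<^sub>1 + \<dots> + t / \<tau>\<^sub>m\<close> of gradients per time \<open>t\<close>, then \<open>m \<le> Y\<close>, because
  each summand is at least 1. The hypothesis for this \<open>m\<close> gives \<open>4 * Y \<le> m + B \<le> Y + B\<close>.
\<close>

lemma fast_rate_le:
  assumes pos: "\<forall>i\<in>{1..n}. 0 < \<tau> i" and "0 < t" and "0 \<le> B"
    and bound: "\<And>m. m \<in> {1..n} \<Longrightarrow> 4 * t * (\<Sum>i=1..m. 1 / ordered_time n \<tau> i) \<le> real m + B"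
  shows "t * (\<Sum>i\<in>{i\<in>{1..n}. \<tau> i \<le> t}. 1 / \<tau> i) \<le> B / 3"
proof (cases "{i\<in>{1..n}. \<tau> i \<le> t} = {}")
  case True
  then show ?thesis
    using \<open>0 \<le> B\<close> by (simp only: sum.empty)
next
  case False
  let ?F = "{i\<in>{1..n}. \<tau> i \<le> t}"
  let ?Y = "t * (\<Sum>i\<in>?F. 1 / \<tau> i)"
  have "card ?F \<le> card {1..n}"
    by (intro card_mono) auto
  moreover have "0 < card ?F"
    using False by (simp only: card_gt_0_iff) auto
  ultimately have "card ?F \<in> {1..n}"
    by simp
  from bound[OF this] have "4 * ?Y \<le> real (card ?F) + B"
    by (simp only: sum_fast_eq_sum_ordered_time[symmetric] mult.assoc)
  moreover have "real (card ?F) \<le> ?Y"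
  proof -
    have "(\<Sum>i\<in>?F. 1) \<le> (\<Sum>i\<in>?F. t * (1 / \<tau> i))"
      using pos by (intro sum_mono) auto
    then show ?thesis
      by (simp only: sum_distrib_left sum_constant mult_1_right)
  qed
  ultimately show ?thesis
    by linarith
qed


section \<open>The lower bound\<close>

lemma lower_bound_term_eq:
  fixes L \<Delta> \<sigma> \<epsilon> p S :: real
  assumes "0 < \<sigma>" "0 < \<epsilon>" "1 < p" and "0 < m"
  shows "inverse ((1 / real m) * S) *
      (L * \<Delta> / \<epsilon>^2 + L * \<sigma> powr (p / (p - 1)) * \<Delta> / (real m * \<epsilon> powr ((3 * p - 2) / (p - 1))))
    = L * \<Delta> / \<epsilon>^2 * ((real m + (\<sigma> / \<epsilon>) powr (p / (p - 1))) / S)"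
proof -
  have "(3 * p - 2) / (p - 1) = 2 + p / (p - 1)"
    using assms by (simp add: field_simps)
  then have "\<epsilon> powr ((3 * p - 2) / (p - 1)) = \<epsilon>^2 * \<epsilon> powr (p / (p - 1))"
    using assms by (simp add: powr_add)
  then have "real m * (L * \<Delta> / \<epsilon>^2
      + L * \<sigma> powr (p / (p - 1)) * \<Delta> / (real m * \<epsilon> powr ((3 * p - 2) / (p - 1))))
    = L * \<Delta> / \<epsilon>^2 * (real m + (\<sigma> / \<epsilon>) powr (p / (p - 1)))"
    using assms by (simp add: powr_divide field_simps)
  moreover have "inverse ((1 / real m) * S) = real m / S"
    by (simp add: divide_inverse mult.commute)
  ultimately show ?thesis
    by (simp only: times_divide_eq_left times_divide_eq_right)
qed

text \<open>
  The remaining work is the choice of parameters. The gradient scale \<open>r = 128 * \<epsilon>\<close> makes \<open>r / 64\<close>, the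
  lower bound for the gradient, equal to \<open>2 * \<epsilon>\<close>, and the length scale \<open>s = 5760 * \<epsilon> / L\<close> makes the
  smoothness constant \<open>45 * r / s\<close> equal to \<open>L\<close>. Each coordinate then uses up
  \<open>2 * r * s = 1474560 * \<epsilon>\<^sup>2 / L\<close> of the gap \<open>\<Delta>\<close>, which determines the dimension. The expected number of
  draws for a success is \<open>max 1 B\<close>, where \<open>B\<close> is a multiple of \<open>(\<sigma> / \<epsilon>)\<^bsup>p/(p-1)\<^esup>\<close> whose factor \<open>\<beta>\<close> is
  dictated by the moment bound \<open>2 * r\<^bsup>p\<^esup> * B\<^bsup>p-1\<^esup> = \<sigma>\<^bsup>p\<^esup>\<close>.
\<close>

lemma time_lower_bound:
  fixes L \<Delta> \<sigma> \<epsilon> p :: real and n :: nat and \<tau> :: "nat \<Rightarrow> real"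
  defines "\<beta> \<equiv> (1 / (2 * 128 powr p)) powr (1 / (p - 1))"
  assumes p: "1 < p" and pos: "0 < L" "0 < \<Delta>" "0 < \<sigma>" "0 < \<epsilon>"
    and n: "1 \<le> n" and tau: "\<forall>i\<in>{1..n}. 0 < \<tau> i"
    and eps: "\<epsilon> \<le> 1 / 2000 * sqrt (L * \<Delta>)"
  shows "\<exists>d f gradf D G.
    L_smooth d L f gradf \<and>
    stochastic_gradient d p \<sigma> gradf D G \<and>
    bdd_below (f ` Rd d) \<and> f zero_vec - (INF x\<in>Rd d. f x) \<le> \<Delta> \<and>
    (\<forall>A. async_algorithm d n A \<longrightarrow>
      ereal (\<beta> / (16 * 1474560) * lower_bound_expr L \<Delta> p \<sigma> \<epsilon> n \<tau>)
        \<le> time_complexity d gradf D G \<tau> A \<epsilon>)"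
proof -
  \<comment> \<open>At least 1 by the bound on \<open>\<epsilon>\<close>, as \<open>2000\<^sup>2 \<ge> 1474560\<close>; so rounding down loses at most a factor 2.\<close>
  define X where "X = L * \<Delta> / (1474560 * \<epsilon>^2)"
  define d where "d = nat \<lfloor>X\<rfloor>"
  have "\<epsilon>^2 \<le> (1 / 2000 * sqrt (L * \<Delta>))^2"
    using eps pos by (intro power_mono) auto
  then have "4000000 * \<epsilon>^2 \<le> L * \<Delta>"
    using pos by (simp add: power_mult_distrib power_divide)
  moreover have "1474560 * \<epsilon>^2 \<le> 4000000 * \<epsilon>^2"
    by simp
  ultimately have "1474560 * \<epsilon>^2 \<le> L * \<Delta>"
    by (rule order_trans[rotated])
  then have "1 \<le> X"
    using pos by (simp add: X_def le_divide_eq)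
  then have "1 \<le> \<lfloor>X\<rfloor>"
    by (simp add: le_floor_iff)
  then have "0 < d" and d_floor: "real d = of_int \<lfloor>X\<rfloor>"
    by (auto simp: d_def)
  have d_le: "real d \<le> X" and d_ge: "X / 2 \<le> real d"
    using \<open>1 \<le> \<lfloor>X\<rfloor>\<close> unfolding d_floor by linarith+
  define r where "r = 128 * \<epsilon>"
  define s where "s = 5760 * \<epsilon> / L"
  have "0 < r" "0 < s"
    using pos by (auto simp: r_def s_def)
  have L_eq: "45 * r / s = L"
    using pos by (simp add: r_def s_def)
  have gap: "2 * real d * (r * s) \<le> \<Delta>"
  proof -
    have "2 * real d * (r * s) \<le> 2 * X * (r * s)"
      using d_le \<open>0 < r\<close> \<open>0 < s\<close> by (intro mult_right_mono mult_left_mono) auto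
    also have "\<dots> = \<Delta>"
      using pos by (simp add: r_def s_def X_def field_simps power2_eq_square)
    finally show ?thesis .
  qed
  define rho where "rho = (\<sigma> / \<epsilon>) powr (p / (p - 1))"
  define B where "B = \<beta> * rho"
  define q where "q = min 1 (1 / B)"
  have "0 < rho" "0 < \<beta>"
    using pos by (auto simp: rho_def \<beta>_def)
  have "\<beta> \<le> 1"
  proof -
    have "1 \<le> 128 powr p"
      using p by (intro ge_one_powr_ge_zero) auto
    then show ?thesis
      unfolding \<beta>_def using p by (intro powr_le1) auto
  qed
  have "0 < B"
    using \<open>0 < rho\<close> \<open>0 < \<beta>\<close> by (simp add: B_def)
  have q01: "0 < q" "q \<le> 1"
    using \<open>0 < B\<close> by (auto simp: q_def)
  have "q * B \<le> 1"
    using \<open>0 < B\<close> by (simp add: q_def min_def field_simps)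
  have moment: "r powr p * (q * (1 / q - 1) powr p + (1 - q)) \<le> \<sigma> powr p"
  proof -
    have "B powr (p - 1) = \<beta> powr (p - 1) * rho powr (p - 1)"
      using \<open>0 < rho\<close> \<open>0 < \<beta>\<close> by (simp add: B_def powr_mult)
    also have "\<beta> powr (p - 1) = 1 / (2 * 128 powr p)"
      using p by (simp add: \<beta>_def powr_powr)
    also have "rho powr (p - 1) = (\<sigma> / \<epsilon>) powr p"
      using p by (simp add: rho_def powr_powr)
    finally have B_powr: "B powr (p - 1) = 1 / (2 * 128 powr p) * (\<sigma> / \<epsilon>) powr p" .
    have "r powr p * (q * (1 / q - 1) powr p + (1 - q)) \<le> r powr p * (2 * B powr (p - 1))"
      using bernoulli_moment_le[OF p \<open>0 < B\<close> q_def] by (intro mult_left_mono) auto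
    also have "\<dots> = \<sigma> powr p"
      using pos unfolding B_powr r_def by (simp add: powr_mult powr_divide)
    finally show ?thesis .
  qed
  let ?f = "hard_fun d r s" and ?g = "hard_grad d r s" and ?D = "coin q"
  let ?G = "frontier_oracle q ?g"
  interpret zero_chain ?g
    by unfold_locales (rule hard_grad_zero_beyond)
  have sg: "stochastic_gradient d p \<sigma> ?g ?D ?G"
    using q01 \<open>0 < r\<close> p moment hard_grad_frontier_le[OF \<open>0 < r\<close>]
    by (intro stochastic_gradient_frontier_oracle[where r = r] measurable_hard_grad) auto
  have bdd: "bdd_below (?f ` Rd d)"
    using hard_fun_lower_bound[OF \<open>0 < r\<close> \<open>0 < s\<close>] by (intro bdd_belowI2)
  have "- \<Delta> \<le> (INF x\<in>Rd d. ?f x)"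
  proof (rule cINF_greatest)
    have "zero_vec \<in> Rd d"
      by (simp add: Rd_iff)
    then show "Rd d \<noteq> {}"
      by blast
    show "- \<Delta> \<le> ?f x" for x
      using hard_fun_lower_bound[OF \<open>0 < r\<close> \<open>0 < s\<close>, of d x] gap by linarith
  qed
  then have init: "?f zero_vec - (INF x\<in>Rd d. ?f x) \<le> \<Delta>"
    using hard_fun_zero_nonpos[OF \<open>0 < r\<close> \<open>0 < s\<close>, of d] by linarith
  have large: "2 * \<epsilon> \<le> norm_Rd d (?g x)" if "x (d - 1) = 0" for x
    using hard_grad_large[of r d x s, OF \<open>0 < r\<close> \<open>0 < d\<close> that] by (simp add: r_def)
  define S where "S m = (\<Sum>i=1..m. 1 / ordered_time n \<tau> i)" for m
  have S_pos: "0 < S m" if "m \<in> {1..n}" for m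
    unfolding S_def using that ordered_time_pos[OF tau] by (intro sum_pos) auto
  define \<mu> where "\<mu> = (MIN m\<in>{1..n}. (real m + B) / S m)"
  have "\<mu> \<in> (\<lambda>m. (real m + B) / S m) ` {1..n}"
    unfolding \<mu>_def using n by (intro Min_in) auto
  then obtain m where m: "m \<in> {1..n}" and mu_eq: "\<mu> = (real m + B) / S m"
    by blast
  have "0 < \<mu>"
    unfolding mu_eq using S_pos[OF m] \<open>0 < B\<close> by (intro divide_pos_pos) auto
  \<comment> \<open>The factor 1/4 turns into the factor 1/3 of \<open>fast_rate_le\<close>.\<close>
  define t where "t = \<mu> / 4"
  have "0 < t"
    using \<open>0 < \<mu>\<close> by (simp add: t_def)
  have "4 * t * S m' \<le> real m' + B" if m': "m' \<in> {1..n}" for m'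
  proof -
    have "\<mu> \<le> (real m' + B) / S m'"
      unfolding \<mu>_def using m' by (intro Min_le) auto
    then show ?thesis
      using S_pos[OF m'] by (simp add: t_def field_simps)
  qed
  then have rate: "t * (\<Sum>i\<in>{i\<in>{1..n}. \<tau> i \<le> t}. 1 / \<tau> i) \<le> B / 3"
    using tau \<open>0 < t\<close> \<open>0 < B\<close> unfolding S_def by (intro fast_rate_le) auto
  have few: "q * (t * (\<Sum>i\<in>{i\<in>{1..n}. \<tau> i \<le> t}. 1 / \<tau> i)) \<le> 1 / 3"
  proof -
    have "q * (t * (\<Sum>i\<in>{i\<in>{1..n}. \<tau> i \<le> t}. 1 / \<tau> i)) \<le> q * (B / 3)"
      using rate q01 by (intro mult_left_mono) auto
    also have "\<dots> \<le> 1 / 3"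
      using \<open>q * B \<le> 1\<close> by simp
    finally show ?thesis .
  qed
  have bound_le: "\<beta> / (16 * 1474560) * lower_bound_expr L \<Delta> p \<sigma> \<epsilon> n \<tau> \<le> real d * t / 2"
  proof -
    have "lower_bound_expr L \<Delta> p \<sigma> \<epsilon> n \<tau> \<le> inverse ((1 / real m) * S m) *
        (L * \<Delta> / \<epsilon>^2 + L * \<sigma> powr (p / (p - 1)) * \<Delta> / (real m * \<epsilon> powr ((3 * p - 2) / (p - 1))))"
      unfolding lower_bound_expr_def S_def using m by (intro Min_le) auto
    also have "\<dots> = L * \<Delta> / \<epsilon>^2 * ((real m + rho) / S m)"
      unfolding rho_def using pos p m by (intro lower_bound_term_eq) auto
    finally have "\<beta> / (16 * 1474560) * lower_bound_expr L \<Delta> p \<sigma> \<epsilon> n \<tau>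
        \<le> \<beta> / (16 * 1474560) * (L * \<Delta> / \<epsilon>^2 * ((real m + rho) / S m))"
      using \<open>0 < \<beta>\<close> by (intro mult_left_mono) auto
    also have "\<dots> = X / 16 * (\<beta> * (real m + rho) / S m)"
      by (simp add: X_def mult_ac)
    also have "\<dots> \<le> X / 16 * \<mu>"
    proof -
      have "\<beta> * real m \<le> 1 * real m"
        using \<open>\<beta> \<le> 1\<close> by (intro mult_right_mono) auto
      then have "\<beta> * (real m + rho) \<le> real m + B"
        by (simp add: B_def distrib_left)
      then show ?thesis
        unfolding mu_eq using \<open>1 \<le> X\<close> S_pos[OF m]
        by (intro mult_left_mono divide_right_mono) simp_all
    qed
    also have "\<dots> \<le> real d * t / 2"
      using mult_right_mono[OF d_ge, of "\<mu> / 8"] \<open>0 < \<mu>\<close> by (simp add: t_def)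
    finally show ?thesis .
  qed
  have "ereal (\<beta> / (16 * 1474560) * lower_bound_expr L \<Delta> p \<sigma> \<epsilon> n \<tau>)
      \<le> time_complexity d ?g ?D ?G \<tau> A \<epsilon>" if A: "async_algorithm d n A" for A
    unfolding time_complexity_def
  proof (rule INF_greatest, clarify)
    fix T assume found: "stationary_found_by d ?g ?D ?G \<tau> A \<epsilon> T"
    interpret async_run d n \<tau> A ?G ?D
      by (rule async_run.intro) (use A sg tau in \<open>simp_all add: stochastic_gradient_def\<close>)
    have "\<not> T \<le> real d * t / 2"
    proof
      assume "T \<le> real d * t / 2"
      then have "\<not> stationary_found_by d ?g ?D ?G \<tau> A \<epsilon> T"
        using q01 by (intro not_stationary_found_by[OF \<open>0 < t\<close> \<open>0 < d\<close> \<open>0 < \<epsilon>\<close> _ supp_frontier_oracle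
            supp_frontier_oracle_of_failure emeasure_coin_1 measurable_hard_grad large few]) simp_all
      then show False
        using found by contradiction
    qed
    then show "ereal (\<beta> / (16 * 1474560) * lower_bound_expr L \<Delta> p \<sigma> \<epsilon> n \<tau>) \<le> ereal T"
      using bound_le by simp
  qed
  then show ?thesis
    using hard_fun_smooth[OF \<open>0 < r\<close> \<open>0 < s\<close>, of d] sg bdd init unfolding L_eq
    by (intro exI[of _ d] exI[of _ ?f] exI[of _ ?g] exI[of _ ?D] exI[of _ ?G] conjI allI impI) simp_all
qed

theorem theorem2:
  shows "\<exists>c>0::real. \<forall>p::real. 1 < p \<and> p \<le> 2 \<longrightarrow>
    (\<exists>C>0::real. \<forall>(L::real) (\<Delta>::real) (\<sigma>::real) (\<epsilon>::real) (n::nat) (\<tau>::nat \<Rightarrow> real).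
      0 < L \<and> 0 < \<Delta> \<and> 0 < \<sigma> \<and> 1 \<le> n \<and> (\<forall>i\<in>{1..n}. 0 < \<tau> i) \<and>
      0 < \<epsilon> \<and> \<epsilon> \<le> c * sqrt (L * \<Delta>) \<longrightarrow>
      (\<exists>(d::nat) (f::vector \<Rightarrow> real) (gradf::vector \<Rightarrow> vector)
          (D::real measure) (G::vector \<Rightarrow> real \<Rightarrow> vector).
        L_smooth d L f gradf \<and>
        stochastic_gradient d p \<sigma> gradf D G \<and>
        bdd_below (f ` Rd d) \<and> f zero_vec - (INF x\<in>Rd d. f x) \<le> \<Delta> \<and>
        (\<forall>A. async_algorithm d n A \<longrightarrow>
          ereal (C * lower_bound_expr L \<Delta> p \<sigma> \<epsilon> n \<tau>) \<le> time_complexity d gradf D G \<tau> A \<epsilon>)))"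
proof (rule exI[of _ "1 / 2000"], intro conjI allI impI, simp)
  fix p :: real
  assume p: "1 < p \<and> p \<le> 2"
  let ?C = "(1 / (2 * 128 powr p)) powr (1 / (p - 1)) / (16 * 1474560)"
  show "\<exists>C>0. \<forall>L \<Delta> \<sigma> \<epsilon> n \<tau>.
      0 < L \<and> 0 < \<Delta> \<and> 0 < \<sigma> \<and> 1 \<le> n \<and> (\<forall>i\<in>{1..n}. 0 < \<tau> i) \<and>
      0 < \<epsilon> \<and> \<epsilon> \<le> 1 / 2000 * sqrt (L * \<Delta>) \<longrightarrow>
      (\<exists>d f gradf D G.
        L_smooth d L f gradf \<and>
        stochastic_gradient d p \<sigma> gradf D G \<and>
        bdd_below (f ` Rd d) \<and> f zero_vec - (INF x\<in>Rd d. f x) \<le> \<Delta> \<and>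
        (\<forall>A. async_algorithm d n A \<longrightarrow>
          ereal (C * lower_bound_expr L \<Delta> p \<sigma> \<epsilon> n \<tau>) \<le> time_complexity d gradf D G \<tau> A \<epsilon>))"
  proof (rule exI[of _ ?C], intro conjI allI impI)
    show "0 < ?C"
      by simp
  next
    fix L \<Delta> \<sigma> \<epsilon> :: real and n :: nat and \<tau> :: "nat \<Rightarrow> real"
    assume "0 < L \<and> 0 < \<Delta> \<and> 0 < \<sigma> \<and> 1 \<le> n \<and> (\<forall>i\<in>{1..n}. 0 < \<tau> i) \<and>
      0 < \<epsilon> \<and> \<epsilon> \<le> 1 / 2000 * sqrt (L * \<Delta>)"
    then show "\<exists>d f gradf D G.
        L_smooth d L f gradf \<and>
        stochastic_gradient d p \<sigma> gradf D G \<and>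
        bdd_below (f ` Rd d) \<and> f zero_vec - (INF x\<in>Rd d. f x) \<le> \<Delta> \<and>
        (\<forall>A. async_algorithm d n A \<longrightarrow>
          ereal (?C * lower_bound_expr L \<Delta> p \<sigma> \<epsilon> n \<tau>) \<le> time_complexity d gradf D G \<tau> A \<epsilon>)"
      using p by (intro time_lower_bound) simp_all
  qed
qed

end
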